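(* Let $n \ge k \ge 2$ be integers and let $H \in \operatorname{Gr}(n,k)$ be a local maximizer of the function $G(H)=\operatorname{vol}_k([-1,1]^n\cap H)$ on $\operatorname{Gr}(n,k)$. For $i\in[n]$ let $v_i$ be the orthogonal projection of the $i$-th vector of the standard basis of $\mathbb{R}^n$ onto $H$. Denote $P=[-1,1]^n\cap H$, understood as a $k$-dimensional polytope in $H$. Then: \begin{enumerate} \item $P=\bigcap_{i\in[n]}\{x\in H: |\langle x,v_i\rangle|\le 1\}$. \item For every $i\in[n]$, $v_i\neq 0$ and the intersection of $P$ with the hyperplane $\{x \in H:\langle x,v_i\rangle=1\}$ is a facet of $P$. \item For every $i\in[n]$, the line $\operatorname{span}\{v_i\}$ intersects the boundary of $P$ in the centroid of a facet of $P$. \item Let $F$ be a facet of $P$ and let $P_F=\operatorname{co}\{0,F\}$. Then $$\frac{\operatorname{vol}_k P_F}{\operatorname{vol}_k P}=\frac12\,\frac{\sum_{\star}|v_i|^2}{k},$$ where the summation is over all indices $i\in[n]$ such that the line $\operatorname{span}\{v_i\}$ intersects $F$ in its centroid. \end{enumerate}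
   Context: $[n]=\{1,\dots,n\}$. $\operatorname{Gr}(n,k)$ is the Grassmannian of $k$-dimensional linear subspaces of $\mathbb{R}^n$ with its usual topology; $H$ is a local maximizer of $G$ if $G(H')\le G(H)$ for all $H'$ in some neighborhood of $H$. $\langle\cdot,\cdot\rangle$ is the standard inner product and $|\cdot|$ the Euclidean norm. $\operatorname{vol}_k$ is $k$-dimensional volume. Boundary and facets of $P$ are taken relative to $H$ (facets are the $(k-1)$-dimensional faces). $\operatorname{co}\{0,F\}$ is the convex hull of $\{0\}\cup F$. The centroid of a facet $F$ is the point $\frac{1}{\operatorname{vol}_{k-1}F}\int_F x\,d\lambda$, where $d\lambda$ is the Lebesgue measure on the hyperplane (of $H$) containing $F$. *)

theory Defs
  imports "HOL-Analysis.Analysis"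
begin

definition orth_proj :: "(real ^ 'n) set \<Rightarrow> real ^ 'n \<Rightarrow> real ^ 'n" where
  "orth_proj H x = (THE y. y \<in> H \<and> (\<forall>z\<in>H. orthogonal (x - y) z))"

lemma orth_proj_ex1:
  fixes H :: "(real ^ 'n) set"
  assumes "subspace H"
  shows "\<exists>!y. y \<in> H \<and> (\<forall>z\<in>H. orthogonal (x - y) z)"
proof -
  obtain y w where y: "y \<in> span H" and w: "\<And>z. z \<in> span H \<Longrightarrow> orthogonal w z" and x: "x = y + w"
    using orthogonal_subspace_decomp_exists[of H x] by metis
  have H: "span H = H"
    using assms by (simp add: span_eq_iff)
  show ?thesis
  proof (rule ex1I)
    show "y \<in> H \<and> (\<forall>z\<in>H. orthogonal (x - y) z)"
      using y w x H by auto
  next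
    fix y' assume y': "y' \<in> H \<and> (\<forall>z\<in>H. orthogonal (x - y') z)"
    have d: "y' - y \<in> H"
      using y y' H assms by (auto intro: subspace_diff)
    have "(x - y) \<bullet> (y' - y) = 0" "(x - y') \<bullet> (y' - y) = 0"
      using w x y' d H by (auto simp: orthogonal_def)
    then have "(y' - y) \<bullet> (y' - y) = 0"
      by (simp add: inner_diff_left)
    then show "y' = y" by simp
  qed
qed

definition grassmannian :: "nat \<Rightarrow> (real ^ 'n) set set" where
  "grassmannian k = {H. subspace H \<and> dim H = k}"

(* The usual topology: Gr(n,k) is identified with the set of orthogonal projection
   matrices of rank k, and carries the subspace topology of the n x n matrices. *)
definition grassmannian_topology :: "nat \<Rightarrow> (real ^ 'n) set topology" where
  "grassmannian_topology k =
     pullback_topology (grassmannian k) (\<lambda>H. matrix (orth_proj H)) euclidean"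

lemma topspace_grassmannian [simp]: "topspace (grassmannian_topology k) = grassmannian k"
  by (simp add: grassmannian_topology_def topspace_pullback_topology)

definition local_maximizer :: "'a topology \<Rightarrow> ('a \<Rightarrow> real) \<Rightarrow> 'a \<Rightarrow> bool" where
  "local_maximizer X f x \<longleftrightarrow> (\<exists>U. openin X U \<and> x \<in> U \<and> (\<forall>y\<in>U. f y \<le> f x))"

definition orthonormal_basis :: "'a::euclidean_space set \<Rightarrow> 'a set \<Rightarrow> bool" where
  "orthonormal_basis B V \<longleftrightarrow>
     pairwise orthogonal B \<and> (\<forall>b\<in>B. norm b = 1) \<and> span B = V"

lemma orthonormal_basis_exists:
  fixes V :: "'a::euclidean_space set"
  assumes "subspace V"
  shows "\<exists>B. orthonormal_basis B V"
  using orthonormal_basis_subspace[OF assms] unfolding orthonormal_basis_def by metis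

(* Lebesgue measure of a linear subspace V, regarded as a Borel measure on the ambient
   space concentrated on V: the image of the product Lebesgue measure under the isometry
   given by orthonormal coordinates (the construction of lborel, with an orthonormal basis
   of V in place of Basis).  It does not depend on the chosen basis. *)
definition subspace_lborel :: "'a::euclidean_space set \<Rightarrow> 'a measure" where
  "subspace_lborel V =
     (let B = (SOME B. orthonormal_basis B V)
      in distr (\<Pi>\<^sub>M b\<in>B. lborel) borel (\<lambda>c. \<Sum>b\<in>B. c b *\<^sub>R b))"

(* Lebesgue measure of a nonempty affine subspace A, by translation from its direction;
   it does not depend on the chosen point of A. *)
definition affine_lborel :: "'a::euclidean_space set \<Rightarrow> 'a measure" where
  "affine_lborel A =
     (let a = (SOME a. a \<in> A)
      in distr (subspace_lborel ((\<lambda>x. x - a) ` A)) borel (\<lambda>x. a + x))"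

(* d-dimensional volume, meant for Borel sets of affine dimension at most d. *)
definition vol :: "nat \<Rightarrow> 'a::euclidean_space set \<Rightarrow> real" where
  "vol d S = (if aff_dim S = int d then measure (affine_lborel (affine hull S)) S else 0)"

(* Meant for sets F of affine dimension d. *)
definition centroid :: "nat \<Rightarrow> 'a::euclidean_space set \<Rightarrow> 'a" where
  "centroid d F = (1 / vol d F) *\<^sub>R (LINT x:F|affine_lborel (affine hull F). x)"

definition cube_section :: "(real ^ 'n) set \<Rightarrow> (real ^ 'n) set" where
  "cube_section H = {x. \<forall>i. x $ i \<in> {-1..1}} \<inter> H"

(* The section is full-dimensional in H, so that the library's facet_of yields its
   (k-1)-dimensional faces, and vol k is its Lebesgue measure in H, for H in Gr(n,k). *)
lemma affine_hull_cube_section: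
  fixes H :: "(real ^ 'n) set"
  assumes "subspace H"
  shows "affine hull (cube_section H) = H"
proof -
  have "interior {x :: real ^ 'n. \<forall>i. x $ i \<in> {-1..1}} \<noteq> {}"
    "0 \<in> interior {x :: real ^ 'n. \<forall>i. x $ i \<in> {-1..1}}"
  proof -
    have "ball 0 1 \<subseteq> {x :: real ^ 'n. \<forall>i. x $ i \<in> {-1..1}}"
    proof
      fix x :: "real ^ 'n" assume "x \<in> ball 0 1"
      then have "\<bar>x $ i\<bar> < 1" for i
        using component_le_norm_cart[of x i] by simp
      then show "x \<in> {x :: real ^ 'n. \<forall>i. x $ i \<in> {-1..1}}"
        by (auto simp: abs_less_iff less_imp_le minus_le_iff)
    qed
    then show "0 \<in> interior {x :: real ^ 'n. \<forall>i. x $ i \<in> {-1..1}}"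
      by (meson centre_in_ball interiorI open_ball zero_less_one)
    then show "interior {x :: real ^ 'n. \<forall>i. x $ i \<in> {-1..1}} \<noteq> {}" by blast
  qed
  moreover have "0 \<in> H" using assms by (rule subspace_0)
  ultimately have "affine hull (H \<inter> {x :: real ^ 'n. \<forall>i. x $ i \<in> {-1..1}}) = affine hull H"
    by (intro affine_hull_convex_Int_nonempty_interior)
       (auto simp: assms subspace_imp_convex)
  then show ?thesis
    using assms by (simp add: cube_section_def Int_commute affine_hull_eq subspace_imp_affine)
qed

lemma aff_dim_cube_section:
  assumes "H \<in> grassmannian k"
  shows "aff_dim (cube_section H) = int k"
  using assms affine_hull_cube_section[of H] aff_dim_affine_hull[of "cube_section H"]
  by (simp add: grassmannian_def aff_dim_subspace)

end

theory Submission
  imports Defs "HOL-Probability.Distributions"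
begin

text \<open>Let \<open>e\<^sub>j\<close> be the standard basis, so that \<open>x $ j = x \<bullet> v j\<close> on \<open>H\<close>. Tilt \<open>H\<close> by the rank-one map
\<open>x \<mapsto> x + t (x \<bullet> w) q\<close> with \<open>w \<in> H\<close> a unit vector and \<open>q\<close> arbitrary. The section of the cube by the
tilted subspace is the image of \<open>C t = {x \<in> H. \<forall>j. \<bar>x \<bullet> v j + t (x \<bullet> w) q $ j\<bar> \<le> 1}\<close>, and the map
multiplies volume by the length of the component of \<open>w + t q\<close> orthogonal to \<open>{x \<in> H. x \<bullet> w = 0}\<close>.
That length is at least \<open>1 + t (q \<bullet> w)\<close>, its component along \<open>w\<close>. Hence local maximality gives
\<open>(1 + t (q \<bullet> w)) vol (C t) \<le> vol P\<close> for small \<open>t\<close> (\<open>local_maximizer_tilt\<close>,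
\<open>norm_tilt_normal_ge\<close>), with equality at \<open>t = 0\<close>: the derivative of the left-hand side at \<open>0\<close>
vanishes.

Now fix \<open>g = v i\<close> or \<open>g = - v i\<close>, and let \<open>q\<close> be the signed sum of the \<open>e\<^sub>j\<close> over the \<open>m\<close> indices with
\<open>v j = g\<close> or \<open>v j = - g\<close>. Then \<open>q \<bullet> x = m (g \<bullet> x)\<close> on \<open>H\<close>, and only the pair of hyperplanes
\<open>x \<bullet> g = 1\<close> and \<open>x \<bullet> g = - 1\<close> moves. All indices of the class have to be moved together, because
\<open>vol (C t)\<close> would in general have a kink at \<open>0\<close> if one of several coinciding hyperplanes moved alone.
The derivative of \<open>vol (C t)\<close> is an integral over \<open>F = P \<inter> {x. x \<bullet> g = 1}\<close>
(\<open>slab_volume_derivative\<close>), and the result is (\<open>first_order_condition\<close>)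
\<open>m (g \<bullet> u) vol P = 2 / \<bar>g\<bar> (\<integral>\<^bsub>F\<^esub> x \<bullet> u)\<close> for all \<open>u\<close>.

This identity contains the theorem. For \<open>u = g\<close> it says that \<open>F\<close> has positive area, so \<open>F\<close> is a
facet. For general \<open>u\<close> it says that the centroid of \<open>F\<close> is \<open>g / \<bar>g\<bar>\<^sup>2\<close>, which lies on the line of
\<open>g\<close>. For \<open>u = v j\<close> and \<open>u = - v j\<close> it bounds the inner products of that point with all \<open>v j\<close>, so
the line leaves \<open>P\<close> exactly there and at the opposite point. Finally the cone over \<open>F\<close> has volume
\<open>area F / (k \<bar>g\<bar>)\<close>, and the case \<open>u = g\<close> turns its share of \<open>vol P\<close> into \<open>m \<bar>g\<bar>\<^sup>2 / (2 k)\<close>; the \<open>m\<close>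
indices of the class are exactly those whose line passes through the centroid.

That no \<open>v i\<close> vanishes is a second-order statement: for \<open>q = e\<^sub>i\<close> orthogonal to \<open>H\<close> the section does
not change while volume is multiplied by \<open>sqrt (1 + t\<^sup>2)\<close>.\<close>

section \<open>Lebesgue measure in linear coordinates\<close>

interpretation lborel_product: product_sigma_finite "\<lambda>_. lborel :: real measure"
  by standard

text \<open>The construction behind \<^const>\<open>subspace_lborel\<close> with the basis as a parameter. The vectors of \<open>B\<close> are
not required to be orthonormal: \<open>nn_integral_subspace_slices\<close> uses a basis with one vector of
arbitrary length.\<close>

definition coord_measure :: "'a::euclidean_space set \<Rightarrow> 'a measure" where
  "coord_measure B = distr (\<Pi>\<^sub>M b\<in>B. lborel) borel (\<lambda>c. \<Sum>b\<in>B. c b *\<^sub>R b)"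

lemma sets_coord_measure [simp, measurable_cong]: "sets (coord_measure B) = sets borel"
  by (simp add: coord_measure_def)

lemma space_coord_measure [simp]: "space (coord_measure B) = UNIV"
  by (simp add: coord_measure_def)

lemma measurable_coordinate_sum [measurable]:
  "(\<lambda>c. \<Sum>b\<in>B. c b *\<^sub>R b) \<in> (\<Pi>\<^sub>M b\<in>B. lborel) \<rightarrow>\<^sub>M (borel :: 'a::euclidean_space measure)"
  by measurable

lemma nn_integral_coord_measure:
  assumes "f \<in> borel_measurable borel"
  shows "integral\<^sup>N (coord_measure B) f = (\<integral>\<^sup>+c. f (\<Sum>b\<in>B. c b *\<^sub>R b) \<partial>(\<Pi>\<^sub>M b\<in>B. lborel))"
  using assms unfolding coord_measure_def by (subst nn_integral_distr) auto

lemma coordinate_sum_upd: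
  fixes B :: "'a::euclidean_space set"
  assumes "finite B" "e \<notin> B"
  shows "(\<Sum>b\<in>insert e B. (c(e := s)) b *\<^sub>R b) = s *\<^sub>R e + (\<Sum>b\<in>B. c b *\<^sub>R b)"
proof -
  have "(\<Sum>b\<in>B. (c(e := s)) b *\<^sub>R b) = (\<Sum>b\<in>B. c b *\<^sub>R b)"
    by (rule sum.cong) (use assms in auto)
  then show ?thesis using assms by simp
qed

lemma nn_integral_coord_measure_insert:
  fixes B :: "'a::euclidean_space set"
  assumes B: "finite B" "e \<notin> B" and f [measurable]: "f \<in> borel_measurable borel"
  shows "integral\<^sup>N (coord_measure (insert e B)) f
           = (\<integral>\<^sup>+y. \<integral>\<^sup>+s. f (s *\<^sub>R e + y) \<partial>lborel \<partial>coord_measure B)"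
    and "integral\<^sup>N (coord_measure (insert e B)) f
           = (\<integral>\<^sup>+s. \<integral>\<^sup>+y. f (s *\<^sub>R e + y) \<partial>coord_measure B \<partial>lborel)"
proof -
  have m: "(\<lambda>c. f (\<Sum>b\<in>insert e B. c b *\<^sub>R b)) \<in> borel_measurable (\<Pi>\<^sub>M b\<in>insert e B. lborel)"
    by measurable
  show "integral\<^sup>N (coord_measure (insert e B)) f
           = (\<integral>\<^sup>+y. \<integral>\<^sup>+s. f (s *\<^sub>R e + y) \<partial>lborel \<partial>coord_measure B)"
    using lborel_product.product_nn_integral_insert[OF B m]
    by (simp add: nn_integral_coord_measure coordinate_sum_upd[OF B] del: sum.insert fun_upd_apply)
  show "integral\<^sup>N (coord_measure (insert e B)) f
           = (\<integral>\<^sup>+s. \<integral>\<^sup>+y. f (s *\<^sub>R e + y) \<partial>coord_measure B \<partial>lborel)"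
    using lborel_product.product_nn_integral_insert_rev[OF B m]
    by (simp add: nn_integral_coord_measure coordinate_sum_upd[OF B] del: sum.insert fun_upd_apply)
qed

lemma nn_integral_coord_measure_empty:
  assumes "f \<in> borel_measurable borel"
  shows "integral\<^sup>N (coord_measure {}) f = f 0"
  using assms emeasure_PiM_empty[of "\<lambda>_. lborel :: real measure"]
  by (simp add: nn_integral_coord_measure space_PiM)

text \<open>By induction on the basis: one coordinate transforms by the affine substitution rule on the real
line, the others by the induction hypothesis. The cases \<open>c = 1\<close> (translations) and \<open>c = - 1\<close>
(reflection) feed the uniqueness argument below; the general case also gives the scaling
\<open>s ^ (k - 1)\<close> of the slices of a cone.\<close>

lemma nn_integral_coord_measure_homothety:
  fixes B :: "'a::euclidean_space set"
  assumes "finite B" "c \<noteq> 0" "a \<in> span B" "f \<in> borel_measurable borel"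
  shows "integral\<^sup>N (coord_measure B) f
           = ennreal (\<bar>c\<bar> ^ card B) * (\<integral>\<^sup>+x. f (c *\<^sub>R x + a) \<partial>coord_measure B)"
  using assms(1,3,4)
proof (induction B arbitrary: a f rule: finite_induct)
  case empty
  then show ?case by (simp add: nn_integral_coord_measure_empty)
next
  case (insert e B)
  note [measurable] = \<open>f \<in> borel_measurable borel\<close>
  obtain \<alpha> a' where a: "a = \<alpha> *\<^sub>R e + a'" and a': "a' \<in> span B"
    using insert.prems(1) by (metis span_breakdown_eq add.commute diff_add_cancel)
  have "(\<integral>\<^sup>+x. f (c *\<^sub>R x + a) \<partial>coord_measure (insert e B))
      = (\<integral>\<^sup>+y. \<integral>\<^sup>+s. f (c *\<^sub>R (s *\<^sub>R e + y) + a) \<partial>lborel \<partial>coord_measure B)"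
    by (rule nn_integral_coord_measure_insert[OF insert.hyps]) measurable
  also have "\<dots> = (\<integral>\<^sup>+y. \<integral>\<^sup>+s. f ((\<alpha> + c * s) *\<^sub>R e + (c *\<^sub>R y + a')) \<partial>lborel \<partial>coord_measure B)"
    by (simp add: a algebra_simps)
  finally have 1: "(\<integral>\<^sup>+x. f (c *\<^sub>R x + a) \<partial>coord_measure (insert e B))
      = (\<integral>\<^sup>+y. \<integral>\<^sup>+s. f ((\<alpha> + c * s) *\<^sub>R e + (c *\<^sub>R y + a')) \<partial>lborel \<partial>coord_measure B)" .
  have "integral\<^sup>N (coord_measure (insert e B)) f
      = (\<integral>\<^sup>+y. \<integral>\<^sup>+s. f (s *\<^sub>R e + y) \<partial>lborel \<partial>coord_measure B)"
    by (rule nn_integral_coord_measure_insert[OF insert.hyps]) measurable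
  also have "\<dots> = ennreal (\<bar>c\<bar> ^ card B) *
      (\<integral>\<^sup>+y. \<integral>\<^sup>+s. f (s *\<^sub>R e + (c *\<^sub>R y + a')) \<partial>lborel \<partial>coord_measure B)"
    by (rule insert.IH[OF a']) measurable
  also have "\<dots> = ennreal (\<bar>c\<bar> ^ card B) *
      (\<integral>\<^sup>+y. ennreal \<bar>c\<bar> * (\<integral>\<^sup>+s. f ((\<alpha> + c * s) *\<^sub>R e + (c *\<^sub>R y + a')) \<partial>lborel) \<partial>coord_measure B)"
    by (subst nn_integral_real_affine[where c = c and t = \<alpha>]) (use assms in auto)
  also have "\<dots> = ennreal (\<bar>c\<bar> ^ card B) * (ennreal \<bar>c\<bar> *
      (\<integral>\<^sup>+y. \<integral>\<^sup>+s. f ((\<alpha> + c * s) *\<^sub>R e + (c *\<^sub>R y + a')) \<partial>lborel \<partial>coord_measure B))"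
    by (subst nn_integral_cmult) auto
  also have "\<dots> = ennreal (\<bar>c\<bar> ^ card (insert e B)) *
      (\<integral>\<^sup>+y. \<integral>\<^sup>+s. f ((\<alpha> + c * s) *\<^sub>R e + (c *\<^sub>R y + a')) \<partial>lborel \<partial>coord_measure B)"
    using insert.hyps by (simp add: ennreal_mult' mult_ac)
  finally show ?case by (simp add: 1)
qed

section \<open>Independence of the orthonormal basis\<close>

lemma orthonormal_basis_independent:
  assumes "orthonormal_basis B V"
  shows "independent B"
proof (rule pairwise_orthogonal_independent)
  show "pairwise orthogonal B" using assms by (simp add: orthonormal_basis_def)
  show "0 \<notin> B" using assms by (force simp add: orthonormal_basis_def)
qed

lemma orthonormal_basis_finite: "orthonormal_basis B V \<Longrightarrow> finite B"
  by (rule independent_imp_finite[OF orthonormal_basis_independent])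

lemma card_orthonormal_basis:
  assumes "orthonormal_basis B V"
  shows "card B = dim V"
proof -
  have "span B = V" using assms by (simp add: orthonormal_basis_def)
  then show ?thesis
    using dim_span_eq_card_independent[OF orthonormal_basis_independent[OF assms]] by simp
qed

lemma norm_coordinate_sum:
  assumes "orthonormal_basis B V"
  shows "(norm (\<Sum>b\<in>B. c b *\<^sub>R b))\<^sup>2 = (\<Sum>b\<in>B. (c b)\<^sup>2)"
proof -
  have "(norm (\<Sum>b\<in>B. c b *\<^sub>R b))\<^sup>2 = (\<Sum>b\<in>B. (norm (c b *\<^sub>R b))\<^sup>2)"
    using assms orthonormal_basis_finite[OF assms]
    by (intro norm_sum_Pythagorean)
       (auto simp: orthonormal_basis_def pairwise_def orthogonal_def)
  then show ?thesis using assms by (simp add: orthonormal_basis_def power_mult_distrib)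
qed

definition gaussian_mass :: ennreal where
  "gaussian_mass = (\<integral>\<^sup>+s. ennreal (exp (- s\<^sup>2)) \<partial>(lborel :: real measure))"

lemma gaussian_mass_bounds: "gaussian_mass \<noteq> 0" "gaussian_mass < \<infinity>"
proof -
  have "integrable lborel (\<lambda>s::real. exp (- s\<^sup>2))"
    using has_bochner_integral_even_function[OF gaussian_moment_0]
    by (simp add: has_bochner_integral_iff)
  then show "gaussian_mass < \<infinity>"
    unfolding gaussian_mass_def by (subst (asm) integrable_iff_bounded) simp
  show "gaussian_mass \<noteq> 0"
  proof
    assume "gaussian_mass = 0"
    then have "AE s in (lborel :: real measure). ennreal (exp (- s\<^sup>2)) = 0"
      unfolding gaussian_mass_def by (subst (asm) nn_integral_0_iff_AE) auto
    then have "AE s in (lborel :: real measure). False" by simp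
    then show False
      by (simp add: eventually_False ae_filter_eq_bot_iff)
  qed
qed

text \<open>In orthonormal coordinates the Gaussian factors into one-dimensional Gaussians. Its integral is
therefore the same number for every orthonormal basis of \<open>V\<close>, which normalizes the
translation-invariant measures compared next.\<close>

lemma nn_integral_gaussian:
  assumes "orthonormal_basis B V"
  shows "(\<integral>\<^sup>+x. ennreal (exp (- (norm x)\<^sup>2)) \<partial>coord_measure B) = gaussian_mass ^ dim V"
proof -
  have fin: "finite B" by (rule orthonormal_basis_finite[OF assms])
  have "(\<integral>\<^sup>+x. ennreal (exp (- (norm x)\<^sup>2)) \<partial>coord_measure B)
      = (\<integral>\<^sup>+c. (\<Prod>b\<in>B. ennreal (exp (- (c b)\<^sup>2))) \<partial>(\<Pi>\<^sub>M b\<in>B. lborel))"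
    using fin by (simp add: nn_integral_coord_measure norm_coordinate_sum[OF assms]
        prod_ennreal exp_sum sum_negf[symmetric])
  also have "\<dots> = (\<Prod>b\<in>B. gaussian_mass)"
    unfolding gaussian_mass_def by (rule lborel_product.product_nn_integral_prod[OF fin]) measurable
  finally show ?thesis using card_orthonormal_basis[OF assms] by simp
qed

text \<open>The classical uniqueness proof for Haar measure. For two translation- and reflection-invariant
measures \<open>\<mu>\<close>, \<open>\<mu>'\<close> on \<open>V\<close>, Fubini and the substitutions \<open>y \<mapsto> y + x\<close>, \<open>x \<mapsto> x - y\<close>, \<open>y \<mapsto> x - y\<close> give
\<open>\<mu> f \<cdot> \<mu>' g = \<mu>' f \<cdot> \<mu> g\<close>. With \<open>g\<close> the Gaussian, the factors \<open>\<mu> g\<close> and \<open>\<mu>' g\<close> agree and are neither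
\<open>0\<close> nor \<open>\<infinity>\<close>.\<close>

lemma coord_measure_basis_independent:
  fixes V :: "'a::euclidean_space set"
  assumes B: "orthonormal_basis B V" and B': "orthonormal_basis B' V"
  shows "coord_measure B = coord_measure B'"
proof (rule measure_eqI)
  have fin: "finite B" "finite B'"
    using B B' by (auto intro: orthonormal_basis_finite)
  define pt :: "'a set \<Rightarrow> ('a \<Rightarrow> real) \<Rightarrow> 'a" where "pt D = (\<lambda>c. \<Sum>b\<in>D. c b *\<^sub>R b)" for D
  have "pt D c \<in> span D" for D c
    unfolding pt_def by (intro span_sum span_scale span_base)
  then have pt: "pt B c \<in> V" "pt B' c \<in> V" for c
    using B B' unfolding orthonormal_basis_def by metis+
  have [measurable]: "pt D \<in> (\<Pi>\<^sub>M b\<in>D. lborel) \<rightarrow>\<^sub>M borel" for D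
    unfolding pt_def by measurable
  have nn: "integral\<^sup>N (coord_measure D) f = (\<integral>\<^sup>+c. f (pt D c) \<partial>(\<Pi>\<^sub>M b\<in>D. lborel))"
    if "f \<in> borel_measurable borel" for D f
    unfolding pt_def by (rule nn_integral_coord_measure[OF that])
  fix A assume "A \<in> sets (coord_measure B)"
  then have A [measurable]: "A \<in> sets borel" by simp
  define f :: "'a \<Rightarrow> ennreal" where "f = indicator A"
  define g :: "'a \<Rightarrow> ennreal" where "g = (\<lambda>x. ennreal (exp (- (norm x)\<^sup>2)))"
  have [measurable]: "f \<in> borel_measurable borel" "g \<in> borel_measurable borel"
    by (auto simp: f_def g_def)
  let ?N = "\<Pi>\<^sub>M b\<in>B. (lborel :: real measure)" and ?N' = "\<Pi>\<^sub>M b\<in>B'. (lborel :: real measure)"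
  interpret N: sigma_finite_measure ?N by (rule lborel_product.sigma_finite[OF fin(1)])
  interpret N': sigma_finite_measure ?N' by (rule lborel_product.sigma_finite[OF fin(2)])
  interpret NN': pair_sigma_finite ?N ?N' ..
  have h1: "integral\<^sup>N (coord_measure D) h = (\<integral>\<^sup>+x. h (x + a) \<partial>coord_measure D)"
    "integral\<^sup>N (coord_measure D) h = (\<integral>\<^sup>+x. h (a - x) \<partial>coord_measure D)"
    if "D = B \<or> D = B'" "a \<in> V" and [measurable]: "h \<in> borel_measurable borel" for D a h
  proof -
    have D: "finite D" "a \<in> span D"
      using that fin B B' unfolding orthonormal_basis_def by metis+
    from nn_integral_coord_measure_homothety[OF D(1) _ D(2) that(3), of 1]
    show "integral\<^sup>N (coord_measure D) h = (\<integral>\<^sup>+x. h (x + a) \<partial>coord_measure D)"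
      by simp
    from nn_integral_coord_measure_homothety[OF D(1) _ D(2) that(3), of "-1"]
    show "integral\<^sup>N (coord_measure D) h = (\<integral>\<^sup>+x. h (a - x) \<partial>coord_measure D)"
      by simp
  qed
  have "integral\<^sup>N (coord_measure B) f * integral\<^sup>N (coord_measure B') g
      = (\<integral>\<^sup>+c. f (pt B c) * (\<integral>\<^sup>+c'. g (pt B' c') \<partial>?N') \<partial>?N)"
    by (simp add: nn nn_integral_multc)
  also have "\<dots> = (\<integral>\<^sup>+c. f (pt B c) * (\<integral>\<^sup>+c'. g (pt B' c' + pt B c) \<partial>?N') \<partial>?N)"
  proof (rule nn_integral_cong)
    fix c
    show "f (pt B c) * (\<integral>\<^sup>+c'. g (pt B' c') \<partial>?N') = f (pt B c) * (\<integral>\<^sup>+c'. g (pt B' c' + pt B c) \<partial>?N')"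
      using h1(1)[OF _ pt(1)[of c], of B' g] by (simp add: nn)
  qed
  also have "\<dots> = (\<integral>\<^sup>+c. \<integral>\<^sup>+c'. f (pt B c) * g (pt B' c' + pt B c) \<partial>?N' \<partial>?N)"
    by (subst nn_integral_cmult) auto
  also have "\<dots> = (\<integral>\<^sup>+c'. \<integral>\<^sup>+c. f (pt B c) * g (pt B' c' + pt B c) \<partial>?N \<partial>?N')"
    by (rule NN'.Fubini'[symmetric]) measurable
  also have "\<dots> = (\<integral>\<^sup>+c'. \<integral>\<^sup>+c. f (pt B c - pt B' c') * g (pt B c) \<partial>?N \<partial>?N')"
  proof (rule nn_integral_cong)
    fix c'
    have "- pt B' c' \<in> V" using pt[of c'] B by (auto simp: orthonormal_basis_def intro: span_neg)
    from h1(1)[OF _ this, of B "\<lambda>x. f x * g (pt B' c' + x)"]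
    show "(\<integral>\<^sup>+c. f (pt B c) * g (pt B' c' + pt B c) \<partial>?N) = (\<integral>\<^sup>+c. f (pt B c - pt B' c') * g (pt B c) \<partial>?N)"
      by (simp add: nn algebra_simps)
  qed
  also have "\<dots> = (\<integral>\<^sup>+c. \<integral>\<^sup>+c'. f (pt B c - pt B' c') * g (pt B c) \<partial>?N' \<partial>?N)"
    by (rule NN'.Fubini') measurable
  also have "\<dots> = (\<integral>\<^sup>+c. (\<integral>\<^sup>+c'. f (pt B c - pt B' c') \<partial>?N') * g (pt B c) \<partial>?N)"
    by (subst nn_integral_multc) auto
  also have "\<dots> = (\<integral>\<^sup>+c. (\<integral>\<^sup>+c'. f (pt B' c') \<partial>?N') * g (pt B c) \<partial>?N)"
  proof (rule nn_integral_cong)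
    fix c
    show "(\<integral>\<^sup>+c'. f (pt B c - pt B' c') \<partial>?N') * g (pt B c) = (\<integral>\<^sup>+c'. f (pt B' c') \<partial>?N') * g (pt B c)"
      using h1(2)[OF _ pt(1)[of c], of B' f] by (simp add: nn)
  qed
  also have "\<dots> = integral\<^sup>N (coord_measure B') f * integral\<^sup>N (coord_measure B) g"
    by (simp add: nn nn_integral_cmult)
  finally have eq: "emeasure (coord_measure B) A * gaussian_mass ^ dim V
      = emeasure (coord_measure B') A * gaussian_mass ^ dim V"
    unfolding f_def g_def nn_integral_gaussian[OF B] nn_integral_gaussian[OF B'] by simp
  have Z: "gaussian_mass ^ dim V \<noteq> 0" "gaussian_mass ^ dim V < \<infinity>"
    using gaussian_mass_bounds by (auto simp: power_less_top_ennreal)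
  have cancel: "x * gaussian_mass ^ dim V / gaussian_mass ^ dim V = x" for x
    using Z by (simp add: ennreal_times_divide[symmetric] ennreal_divide_self)
  show "emeasure (coord_measure B) A = emeasure (coord_measure B') A"
    using arg_cong[OF eq, of "\<lambda>x. x / gaussian_mass ^ dim V"] by (simp only: cancel)
qed (simp only: sets_coord_measure)

lemma subspace_lborel_eq_coord_measure:
  assumes "orthonormal_basis B V"
  shows "subspace_lborel V = coord_measure B"
proof -
  have "orthonormal_basis (SOME B. orthonormal_basis B V) V"
    using assms by (rule someI)
  from coord_measure_basis_independent[OF this assms] show ?thesis
    by (simp add: subspace_lborel_def coord_measure_def Let_def)
qed

section \<open>Lebesgue measure of a linear subspace\<close>

lemma sets_subspace_lborel [simp, measurable_cong]: "sets (subspace_lborel V) = sets borel"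
  by (simp add: subspace_lborel_def Let_def)

lemma space_subspace_lborel [simp]: "space (subspace_lborel V) = UNIV"
  by (simp add: subspace_lborel_def Let_def)

lemma subspace_orthogonal_section:
  assumes "subspace V"
  shows "subspace {x \<in> V. x \<bullet> z = (0::real)}"
  using assms by (auto simp: subspace_def inner_left_distrib)

lemma closed_subspace_borel:
  fixes V :: "'a::euclidean_space set"
  shows "subspace V \<Longrightarrow> V \<in> sets borel"
  by (intro borel_closed closed_subspace)

lemma orthonormal_basis_insert:
  fixes V :: "'a::euclidean_space set"
  assumes V: "subspace V" and z: "z \<in> V" "z \<noteq> 0"
    and B: "orthonormal_basis B {x \<in> V. x \<bullet> z = 0}"
  shows "orthonormal_basis (insert (z /\<^sub>R norm z) B) V" "z /\<^sub>R norm z \<notin> B" "z \<notin> B"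
proof -
  let ?e = "z /\<^sub>R norm z"
  have span: "span B = {x \<in> V. x \<bullet> z = 0}" and pw: "pairwise orthogonal B"
    and nrm: "\<forall>b\<in>B. norm b = 1"
    using B by (simp_all add: orthonormal_basis_def)
  have B_sub: "b \<in> V" "b \<bullet> z = 0" if "b \<in> B" for b
    using span_base[OF that] unfolding span by auto
  show "?e \<notin> B" "z \<notin> B" using B_sub(2)[of ?e] B_sub(2)[of z] z by auto
  have zz: "z \<bullet> z = norm z * norm z" by (simp add: power2_eq_square[symmetric] power2_norm_eq_inner)
  have "span (insert ?e B) = V"
  proof (intro equalityI subsetI)
    have "insert ?e B \<subseteq> V" using B_sub z V by (auto intro: subspace_scale)
    then show "x \<in> V" if "x \<in> span (insert ?e B)" for x
      using span_minimal[OF _ V] that by blast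
  next
    fix x assume x: "x \<in> V"
    have "x - (x \<bullet> ?e) *\<^sub>R ?e \<in> span B"
      unfolding span using x z V zz
      by (auto simp: inner_diff_left divide_simps intro!: subspace_diff subspace_scale)
    then show "x \<in> span (insert ?e B)" by (metis span_breakdown_eq)
  qed
  moreover have "pairwise orthogonal (insert ?e B)"
    using pw B_sub(2) by (auto simp: pairwise_insert orthogonal_def inner_commute)
  moreover have "norm ?e = 1" using z by simp
  ultimately show "orthonormal_basis (insert ?e B) V"
    using nrm unfolding orthonormal_basis_def by auto
qed

text \<open>Fubini along a direction \<open>z\<close> of arbitrary length. The factor \<open>norm z\<close> is the Jacobian of the
parameter \<open>s\<close>; this one formula yields the volume change under a tilt (\<open>z\<close> the new normal), the
decomposition of the polytope along a facet normal, and the volume of a cone.\<close>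

lemma nn_integral_subspace_slices:
  fixes V :: "'a::euclidean_space set" and z :: 'a
  assumes V: "subspace V" and z: "z \<in> V" "z \<noteq> 0" and f [measurable]: "f \<in> borel_measurable borel"
  shows "integral\<^sup>N (subspace_lborel V) f
       = ennreal (norm z) * (\<integral>\<^sup>+y. \<integral>\<^sup>+s. f (s *\<^sub>R z + y) \<partial>lborel \<partial>subspace_lborel {x \<in> V. x \<bullet> z = 0})"
    and "(\<integral>\<^sup>+y. \<integral>\<^sup>+s. f (s *\<^sub>R z + y) \<partial>lborel \<partial>subspace_lborel {x \<in> V. x \<bullet> z = 0})
       = (\<integral>\<^sup>+s. \<integral>\<^sup>+y. f (s *\<^sub>R z + y) \<partial>subspace_lborel {x \<in> V. x \<bullet> z = 0} \<partial>lborel)"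
proof -
  obtain B where B: "orthonormal_basis B {x \<in> V. x \<bullet> z = 0}"
    using orthonormal_basis_exists[OF subspace_orthogonal_section[OF V]] by blast
  note ins = orthonormal_basis_insert[OF V z B] and fin = orthonormal_basis_finite[OF B]
  have "integral\<^sup>N (coord_measure (insert (z /\<^sub>R norm z) B)) f
      = (\<integral>\<^sup>+y. \<integral>\<^sup>+s. f (s *\<^sub>R (z /\<^sub>R norm z) + y) \<partial>lborel \<partial>coord_measure B)"
    by (rule nn_integral_coord_measure_insert(1)[OF fin ins(2) f])
  also have "\<dots> = (\<integral>\<^sup>+y. ennreal (norm z) * (\<integral>\<^sup>+s. f (s *\<^sub>R z + y) \<partial>lborel) \<partial>coord_measure B)"
  proof (rule nn_integral_cong)
    fix y
    have "(\<integral>\<^sup>+s. f (s *\<^sub>R (z /\<^sub>R norm z) + y) \<partial>lborel)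
        = ennreal \<bar>norm z\<bar> * (\<integral>\<^sup>+s. f ((0 + norm z * s) *\<^sub>R (z /\<^sub>R norm z) + y) \<partial>lborel)"
      by (rule nn_integral_real_affine) (use z in auto)
    then show "(\<integral>\<^sup>+s. f (s *\<^sub>R (z /\<^sub>R norm z) + y) \<partial>lborel)
        = ennreal (norm z) * (\<integral>\<^sup>+s. f (s *\<^sub>R z + y) \<partial>lborel)"
      using z by (simp add: field_simps)
  qed
  also have "\<dots> = ennreal (norm z) * (\<integral>\<^sup>+y. \<integral>\<^sup>+s. f (s *\<^sub>R z + y) \<partial>lborel \<partial>coord_measure B)"
    by (rule nn_integral_cmult) measurable
  finally show "integral\<^sup>N (subspace_lborel V) f
       = ennreal (norm z) * (\<integral>\<^sup>+y. \<integral>\<^sup>+s. f (s *\<^sub>R z + y) \<partial>lborel \<partial>subspace_lborel {x \<in> V. x \<bullet> z = 0})"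
    unfolding subspace_lborel_eq_coord_measure[OF ins(1)] subspace_lborel_eq_coord_measure[OF B] .
  show "(\<integral>\<^sup>+y. \<integral>\<^sup>+s. f (s *\<^sub>R z + y) \<partial>lborel \<partial>subspace_lborel {x \<in> V. x \<bullet> z = 0})
       = (\<integral>\<^sup>+s. \<integral>\<^sup>+y. f (s *\<^sub>R z + y) \<partial>subspace_lborel {x \<in> V. x \<bullet> z = 0} \<partial>lborel)"
    unfolding subspace_lborel_eq_coord_measure[OF B]
    using nn_integral_coord_measure_insert[OF fin ins(3) f] by simp
qed

lemma nn_integral_subspace_homothety:
  fixes V :: "'a::euclidean_space set"
  assumes V: "subspace V" and c: "c \<noteq> 0" and a: "a \<in> V" and f: "f \<in> borel_measurable borel"
  shows "integral\<^sup>N (subspace_lborel V) f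
           = ennreal (\<bar>c\<bar> ^ dim V) * (\<integral>\<^sup>+x. f (c *\<^sub>R x + a) \<partial>subspace_lborel V)"
proof -
  obtain B where B: "orthonormal_basis B V"
    using orthonormal_basis_exists[OF V] by blast
  have "a \<in> span B" using a B by (simp add: orthonormal_basis_def)
  from nn_integral_coord_measure_homothety[OF orthonormal_basis_finite[OF B] c this f]
  show ?thesis
    by (simp only: subspace_lborel_eq_coord_measure[OF B] card_orthonormal_basis[OF B])
qed

lemma emeasure_subspace_homothety:
  fixes V :: "'a::euclidean_space set"
  assumes V: "subspace V" and c: "c \<noteq> 0" and a: "a \<in> V" and S [measurable]: "S \<in> sets borel"
  shows "emeasure (subspace_lborel V) S
           = ennreal (\<bar>c\<bar> ^ dim V) * emeasure (subspace_lborel V) {x. c *\<^sub>R x + a \<in> S}"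
proof -
  have "integral\<^sup>N (subspace_lborel V) (indicator S)
           = ennreal (\<bar>c\<bar> ^ dim V) * (\<integral>\<^sup>+x. indicator S (c *\<^sub>R x + a) \<partial>subspace_lborel V)"
    by (rule nn_integral_subspace_homothety[OF V c a]) measurable
  also have "(\<integral>\<^sup>+x. indicator S (c *\<^sub>R x + a) \<partial>subspace_lborel V)
      = (\<integral>\<^sup>+x. indicator {x. c *\<^sub>R x + a \<in> S} x \<partial>subspace_lborel V)"
    by (rule nn_integral_cong) (simp add: indicator_def)
  also have "\<dots> = emeasure (subspace_lborel V) {x. c *\<^sub>R x + a \<in> S}"
    by (rule nn_integral_indicator) measurable
  finally show ?thesis by simp
qed

lemma AE_subspace_lborel:
  fixes V :: "'a::euclidean_space set"
  assumes V: "subspace V"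
  shows "AE x in subspace_lborel V. x \<in> V"
proof -
  obtain B where B: "orthonormal_basis B V"
    using orthonormal_basis_exists[OF V] by blast
  note [measurable] = closed_subspace_borel[OF V]
  have "(\<Sum>b\<in>B. c b *\<^sub>R b) \<in> span B" for c
    by (intro span_sum span_scale span_base)
  then have mem: "(\<Sum>b\<in>B. c b *\<^sub>R b) \<in> V" for c
    using B by (simp add: orthonormal_basis_def)
  show ?thesis
    unfolding subspace_lborel_eq_coord_measure[OF B] coord_measure_def
    by (subst AE_distr_iff) (use mem in auto)
qed

lemma nn_integral_subspace_gaussian:
  fixes V :: "'a::euclidean_space set"
  assumes V: "subspace V"
  shows "(\<integral>\<^sup>+x. ennreal (exp (- (norm x)\<^sup>2)) \<partial>subspace_lborel V) = gaussian_mass ^ dim V"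
  using orthonormal_basis_exists[OF V] nn_integral_gaussian subspace_lborel_eq_coord_measure
  by fastforce

text \<open>The indicator of a ball is at most a multiple of the Gaussian.\<close>

lemma emeasure_subspace_bounded_finite:
  fixes V :: "'a::euclidean_space set"
  assumes V: "subspace V" and S: "bounded S"
  shows "emeasure (subspace_lborel V) S < \<infinity>"
proof -
  obtain R where R: "\<And>x. x \<in> S \<Longrightarrow> norm x \<le> R" using S by (auto simp: bounded_iff)
  have "emeasure (subspace_lborel V) S \<le> emeasure (subspace_lborel V) (cball 0 R)"
    by (rule emeasure_mono) (use R in auto)
  also have "\<dots> = (\<integral>\<^sup>+x. indicator (cball 0 R) x \<partial>subspace_lborel V)" by simp
  also have "\<dots> \<le> (\<integral>\<^sup>+x. ennreal (exp (R\<^sup>2)) * ennreal (exp (- (norm x)\<^sup>2)) \<partial>subspace_lborel V)"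
  proof (rule nn_integral_mono)
    fix x
    show "indicator (cball 0 R) x \<le> ennreal (exp (R\<^sup>2)) * ennreal (exp (- (norm x)\<^sup>2))"
    proof (cases "norm x \<le> R")
      case True
      then have "(norm x)\<^sup>2 \<le> R\<^sup>2" by (simp add: power_mono)
      then have "1 \<le> exp (R\<^sup>2) * exp (- (norm x)\<^sup>2)"
        by (simp add: exp_add[symmetric])
      then show ?thesis using True by (simp add: ennreal_mult'[symmetric])
    qed simp
  qed
  also have "\<dots> = ennreal (exp (R\<^sup>2)) * gaussian_mass ^ dim V"
    by (subst nn_integral_cmult) (auto simp: nn_integral_subspace_gaussian[OF V])
  also have "\<dots> < \<infinity>"
    using gaussian_mass_bounds by (simp add: ennreal_mult_less_top power_less_top_ennreal)
  finally show ?thesis .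
qed

text \<open>If one ball about \<open>0\<close> were null, then by scaling all of them would be, and the Gaussian would have
integral \<open>0\<close>.\<close>

lemma emeasure_subspace_ball_pos:
  fixes V :: "'a::euclidean_space set"
  assumes V: "subspace V" and r: "r > 0"
  shows "emeasure (subspace_lborel V) (ball 0 r) > 0"
proof (rule ccontr)
  assume "\<not> ?thesis"
  then have z: "emeasure (subspace_lborel V) (ball 0 r) = 0" by (simp add: not_less)
  have "emeasure (subspace_lborel V) (ball 0 (real (Suc n))) = 0" for n
  proof -
    define c where "c = real (Suc n) / r"
    have c: "c > 0" using r by (simp add: c_def)
    have "real (Suc n) = c * r" using r by (simp add: c_def)
    then have "{x::'a. c *\<^sub>R x + 0 \<in> ball 0 (real (Suc n))} = ball 0 r"
      using c by (auto simp del: of_nat_Suc)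
    with emeasure_subspace_homothety[OF V _ subspace_0[OF V], of c "ball 0 (real (Suc n))"] c z
    show ?thesis by simp
  qed
  then have "emeasure (subspace_lborel V) (\<Union>n. ball 0 (real (Suc n))) = 0"
    by (intro emeasure_UN_eq_0) auto
  moreover have "(\<Union>n. ball (0::'a) (real (Suc n))) = UNIV"
  proof -
    have "\<exists>n. norm x < real (Suc n)" for x :: 'a
      using reals_Archimedean2[of "norm x"] by (metis less_trans lessI of_nat_less_iff)
    then show ?thesis by auto
  qed
  ultimately have "emeasure (subspace_lborel V) UNIV = 0" by simp
  then have "AE x in subspace_lborel V. ennreal (exp (- (norm x)\<^sup>2)) = 0"
    by (intro AE_I[of _ _ UNIV]) auto
  then have "(\<integral>\<^sup>+x. ennreal (exp (- (norm x)\<^sup>2)) \<partial>subspace_lborel V) = 0"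
    by (subst nn_integral_0_iff_AE) auto
  then show False
    using gaussian_mass_bounds by (simp add: nn_integral_subspace_gaussian[OF V])
qed

lemma emeasure_subspace_hyperplane:
  fixes V :: "'a::euclidean_space set"
  assumes V: "subspace V" and a: "a \<in> V" "a \<noteq> 0"
  shows "emeasure (subspace_lborel V) {x. x \<bullet> a = d} = 0"
proof -
  have inner0: "(\<integral>\<^sup>+s. indicator {x. x \<bullet> a = d} (s *\<^sub>R a + y) \<partial>lborel) = 0" if "y \<bullet> a = 0" for y
  proof -
    have "(\<integral>\<^sup>+s. indicator {x. x \<bullet> a = d} (s *\<^sub>R a + y) \<partial>lborel)
        = (\<integral>\<^sup>+s. indicator {d / (a \<bullet> a)} s \<partial>lborel)"
      using a that by (intro nn_integral_cong) (auto simp: indicator_def inner_left_distrib field_simps)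
    then show ?thesis by simp
  qed
  have W: "subspace {x \<in> V. x \<bullet> a = 0}" by (rule subspace_orthogonal_section[OF V])
  have "AE y in subspace_lborel {x \<in> V. x \<bullet> a = 0}.
      (\<integral>\<^sup>+s. indicator {x. x \<bullet> a = d} (s *\<^sub>R a + y) \<partial>lborel) = 0"
    using AE_subspace_lborel[OF W] by eventually_elim (simp add: inner0)
  then have "(\<integral>\<^sup>+y. \<integral>\<^sup>+s. indicator {x. x \<bullet> a = d} (s *\<^sub>R a + y) \<partial>lborel
      \<partial>subspace_lborel {x \<in> V. x \<bullet> a = 0}) = 0"
    by (subst nn_integral_0_iff_AE) auto
  moreover have "emeasure (subspace_lborel V) {x. x \<bullet> a = d}
      = integral\<^sup>N (subspace_lborel V) (indicator {x. x \<bullet> a = d})" by simp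
  ultimately show ?thesis
    by (subst (asm) nn_integral_subspace_slices(1)[OF V a]) auto
qed

text \<open>The base point selected in \<^const>\<open>affine_lborel\<close> may be replaced by any other point of the
affine subspace, since \<open>subspace_lborel V\<close> is invariant under translations by \<open>V\<close>.\<close>

lemma affine_lborel_translate:
  fixes V :: "'a::euclidean_space set"
  assumes V: "subspace V"
  shows "affine_lborel ((+) a ` V) = distr (subspace_lborel V) borel ((+) a)"
proof -
  define a' where "a' = (SOME x. x \<in> (+) a ` V)"
  have "a + 0 \<in> (+) a ` V" using subspace_0[OF V] by blast
  then have "a' \<in> (+) a ` V" unfolding a'_def by (rule someI)
  then obtain v where v: "v \<in> V" "a' = a + v" by auto
  have "(\<lambda>x. x - a') ` ((+) a ` V) = V"
  proof (intro equalityI subsetI)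
    fix y assume "y \<in> V"
    then have "y + v \<in> V" using v V by (auto intro: subspace_add)
    moreover have "y = a + (y + v) - a'" using v by simp
    ultimately show "y \<in> (\<lambda>x. x - a') ` ((+) a ` V)" by blast
  qed (use v V in \<open>auto intro: subspace_diff\<close>)
  then have "affine_lborel ((+) a ` V) = distr (subspace_lborel V) borel ((+) a')"
    by (simp add: affine_lborel_def a'_def[symmetric] Let_def)
  also have "\<dots> = distr (subspace_lborel V) borel ((+) a)"
  proof (rule measure_eqI)
    fix S assume "S \<in> sets (distr (subspace_lborel V) borel ((+) a'))"
    then have S [measurable]: "S \<in> sets borel" by simp
    have "emeasure (subspace_lborel V) {x. a + x \<in> S}
        = emeasure (subspace_lborel V) {x. 1 *\<^sub>R x + v \<in> {x. a + x \<in> S}}"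
      using emeasure_subspace_homothety[OF V _ v(1), of 1 "{x. a + x \<in> S}"] by simp
    also have "{x. 1 *\<^sub>R x + v \<in> {x. a + x \<in> S}} = {x. a' + x \<in> S}"
      by (simp add: v add_ac)
    finally show "emeasure (distr (subspace_lborel V) borel ((+) a')) S
        = emeasure (distr (subspace_lborel V) borel ((+) a)) S"
      by (simp add: emeasure_distr vimage_def)
  qed simp
  finally show ?thesis .
qed

section \<open>Orthogonal projections and cube sections\<close>

lemma orth_proj_eqI:
  assumes "subspace H" "y \<in> H" "\<And>z. z \<in> H \<Longrightarrow> (x - y) \<bullet> z = 0"
  shows "orth_proj H x = y"
  unfolding orth_proj_def
  by (rule the1_equality[OF orth_proj_ex1[OF assms(1)]]) (use assms in \<open>auto simp: orthogonal_def\<close>)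

lemma orth_proj_mem: "subspace H \<Longrightarrow> orth_proj H x \<in> H"
  and orth_proj_residual: "subspace H \<Longrightarrow> z \<in> H \<Longrightarrow> (x - orth_proj H x) \<bullet> z = 0"
proof -
  have *: "orth_proj H x \<in> H \<and> (\<forall>z\<in>H. orthogonal (x - orth_proj H x) z)" if "subspace H"
    unfolding orth_proj_def by (rule theI'[OF orth_proj_ex1[OF that]])
  show "subspace H \<Longrightarrow> orth_proj H x \<in> H" using * by blast
  show "subspace H \<Longrightarrow> z \<in> H \<Longrightarrow> (x - orth_proj H x) \<bullet> z = 0"
    using * by (simp add: orthogonal_def)
qed

lemma orth_proj_inner: "subspace H \<Longrightarrow> z \<in> H \<Longrightarrow> z \<bullet> orth_proj H x = z \<bullet> x"
  using orth_proj_residual[of H z x] by (simp add: inner_diff_left inner_commute[of z])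

lemma cube_section_eq: "cube_section H = {x \<in> H. \<forall>j. \<bar>x $ j\<bar> \<le> 1}"
  by (auto simp: cube_section_def abs_le_iff minus_le_iff)

lemma closed_cube_section:
  assumes "subspace H"
  shows "closed (cube_section H)"
proof -
  have "cube_section H = H \<inter> (\<Inter>j. {x. \<bar>x $ j\<bar> \<le> 1})"
    by (auto simp: cube_section_eq)
  moreover have "closed {x :: real ^ 'n. \<bar>x $ j\<bar> \<le> 1}" for j
    by (intro closed_Collect_le continuous_intros)
  ultimately show ?thesis using closed_subspace[OF assms] by (simp only:) (intro closed_Int closed_INT ballI)
qed

lemma bounded_unit_cube: "bounded {x :: real ^ 'n. \<forall>j. \<bar>x $ j\<bar> \<le> 1}"
proof (rule boundedI)
  fix x :: "real ^ 'n" assume "x \<in> {x. \<forall>j. \<bar>x $ j\<bar> \<le> 1}"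
  then show "norm x \<le> (\<Sum>j\<in>(UNIV :: 'n set). 1)"
    using norm_le_l1_cart[of x] sum_mono[of UNIV "\<lambda>j. \<bar>x $ j\<bar>" "\<lambda>_. 1"] by fastforce
qed

lemma bounded_cube_section: "bounded (cube_section H)"
  by (rule bounded_subset[OF bounded_unit_cube]) (auto simp: cube_section_eq)

lemma vol_eq_subspace_measure:
  fixes S :: "'a::euclidean_space set"
  assumes V: "subspace V" and S: "affine hull S = (+) a ` V" "aff_dim S = int d" and m: "S \<in> sets borel"
  shows "vol d S = measure (subspace_lborel V) {y. a + y \<in> S}"
  using S m by (simp add: vol_def affine_lborel_translate[OF V] measure_distr vimage_def)

lemma vol_cube_section:
  assumes H: "H \<in> grassmannian k"
  shows "vol k (cube_section H) = measure (subspace_lborel H) (cube_section H)"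
proof -
  have sub: "subspace H" using H by (simp add: grassmannian_def)
  have "(+) 0 ` H = H" by force
  then show ?thesis
    using vol_eq_subspace_measure[OF sub, of "cube_section H" 0 k] affine_hull_cube_section[OF sub]
      aff_dim_cube_section[OF H] closed_cube_section[OF sub] by simp
qed

section \<open>Rank-one perturbations of a subspace\<close>

text \<open>Only coordinates in the support of \<open>q\<close> change, so the choice of \<open>q\<close> decides which of the constraints
\<open>\<bar>x $ j\<bar> \<le> 1\<close> are perturbed.\<close>

definition tilt :: "real ^ 'n \<Rightarrow> real ^ 'n \<Rightarrow> real \<Rightarrow> real ^ 'n \<Rightarrow> real ^ 'n" where
  "tilt w q t x = x + (t * (x \<bullet> w)) *\<^sub>R q"

text \<open>The component of the tilted axis \<open>w + t q\<close> orthogonal to \<open>{x \<in> H. x \<bullet> w = 0}\<close>. That hyperplane of \<open>H\<close> is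
fixed by the tilt, so the tilted subspace is its orthogonal sum with the line of this vector.\<close>

definition tilt_normal :: "(real ^ 'n) set \<Rightarrow> real ^ 'n \<Rightarrow> real ^ 'n \<Rightarrow> real \<Rightarrow> real ^ 'n" where
  "tilt_normal H w q t = w + t *\<^sub>R (q - orth_proj {x \<in> H. x \<bullet> w = 0} q)"

lemma linear_tilt: "linear (tilt w q t)"
  unfolding tilt_def by (auto intro!: linearI simp: algebra_simps inner_left_distrib)

context
  fixes H :: "(real ^ 'n) set" and w q :: "real ^ 'n" and H0
  assumes H: "subspace H" and w: "w \<in> H" "norm w = 1"
  defines "H0 \<equiv> {x \<in> H. x \<bullet> w = 0}"
begin

lemma subspace_axis_complement: "subspace H0"
  unfolding H0_def by (rule subspace_orthogonal_section[OF H])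

lemma tilt_normal_orthogonal: "y \<in> H0 \<Longrightarrow> y \<bullet> tilt_normal H w q t = 0"
  using orth_proj_inner[OF subspace_axis_complement, of y q]
  unfolding tilt_normal_def H0_def[symmetric]
  by (simp add: inner_right_distrib inner_diff_right) (simp add: H0_def)

lemma tilt_normal_inner_axis: "tilt_normal H w q t \<bullet> w = 1 + t * (q \<bullet> w)"
proof -
  have "w \<bullet> w = 1" using w by (simp add: norm_eq_1)
  moreover have "orth_proj H0 q \<bullet> w = 0"
    using orth_proj_mem[OF subspace_axis_complement, of q] by (simp add: H0_def)
  ultimately show ?thesis
    unfolding tilt_normal_def H0_def[symmetric] by (simp add: inner_left_distrib inner_diff_left)
qed

text \<open>The Jacobian of the tilt is bounded below by the Jacobian of the tilt followed by the orthogonal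
projection back to \<open>H\<close>. This linear bound suffices for first-order conditions, since it is sharp at
\<open>t = 0\<close>.\<close>

lemma norm_tilt_normal_ge: "1 + t * (q \<bullet> w) \<le> norm (tilt_normal H w q t)"
  using norm_cauchy_schwarz[of "tilt_normal H w q t" w] w by (simp add: tilt_normal_inner_axis)

text \<open>In coordinates adapted to both subspaces the tilt sends \<open>w\<close> to its new normal and shears the fixed
hyperplane within itself.\<close>

lemma tilt_decomp: "tilt w q t (s *\<^sub>R w + y)
    = s *\<^sub>R tilt_normal H w q t + (y + (s * t) *\<^sub>R orth_proj H0 q)" if "y \<in> H0"
proof -
  have "w \<bullet> w = 1" using w by (simp add: norm_eq_1)
  then show ?thesis
    using that unfolding tilt_def tilt_normal_def H0_def[symmetric]
    by (simp add: H0_def inner_left_distrib algebra_simps)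
qed

lemma tilt_image: "tilt w q t ` H = {s *\<^sub>R tilt_normal H w q t + y |s y. y \<in> H0}"
proof (intro equalityI subsetI)
  have ww: "w \<bullet> w = 1" using w by (simp add: norm_eq_1)
  note p = orth_proj_mem[OF subspace_axis_complement, of q]
  note sub = subspace_axis_complement
  fix v assume "v \<in> tilt w q t ` H"
  then obtain x where x: "x \<in> H" "v = tilt w q t x" by blast
  have y: "x - (x \<bullet> w) *\<^sub>R w \<in> H0"
    using x w H ww by (auto simp: H0_def inner_diff_left intro!: subspace_diff subspace_scale)
  have "v = (x \<bullet> w) *\<^sub>R tilt_normal H w q t
      + ((x - (x \<bullet> w) *\<^sub>R w) + ((x \<bullet> w) * t) *\<^sub>R orth_proj H0 q)"
    using tilt_decomp[OF y, of t "x \<bullet> w"] x by simp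
  moreover have "(x - (x \<bullet> w) *\<^sub>R w) + ((x \<bullet> w) * t) *\<^sub>R orth_proj H0 q \<in> H0"
    using y p sub by (intro subspace_add subspace_scale)
  ultimately show "v \<in> {s *\<^sub>R tilt_normal H w q t + y |s y. y \<in> H0}" by blast
next
  note p = orth_proj_mem[OF subspace_axis_complement, of q]
  note sub = subspace_axis_complement
  fix v assume "v \<in> {s *\<^sub>R tilt_normal H w q t + y |s y. y \<in> H0}"
  then obtain s y where y: "y \<in> H0" "v = s *\<^sub>R tilt_normal H w q t + y" by blast
  have y': "y - (s * t) *\<^sub>R orth_proj H0 q \<in> H0"
    using y p sub by (intro subspace_diff subspace_scale)
  then have "s *\<^sub>R w + (y - (s * t) *\<^sub>R orth_proj H0 q) \<in> H"
    using w H by (auto simp: H0_def intro!: subspace_add subspace_scale)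
  moreover have "v = tilt w q t (s *\<^sub>R w + (y - (s * t) *\<^sub>R orth_proj H0 q))"
    using tilt_decomp[OF y', of t s] y by simp
  ultimately show "v \<in> tilt w q t ` H" by blast
qed

lemma subspace_tilt_image: "subspace (tilt w q t ` H)"
  by (rule linear_subspace_image[OF linear_tilt H])

lemma tilt_image_complement:
  assumes "tilt_normal H w q t \<noteq> 0"
  shows "{x \<in> tilt w q t ` H. x \<bullet> tilt_normal H w q t = 0} = H0"
proof (intro equalityI subsetI)
  fix x assume "x \<in> {x \<in> tilt w q t ` H. x \<bullet> tilt_normal H w q t = 0}"
  then obtain s y where "y \<in> H0" "x = s *\<^sub>R tilt_normal H w q t + y"
    and "x \<bullet> tilt_normal H w q t = 0"
    unfolding tilt_image by blast
  then show "x \<in> H0" using assms by (auto simp: inner_left_distrib tilt_normal_orthogonal)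
next
  fix x assume x: "x \<in> H0"
  then have "x = 0 *\<^sub>R tilt_normal H w q t + x" by simp
  with x have "x \<in> tilt w q t ` H" unfolding tilt_image by blast
  with x show "x \<in> {x \<in> tilt w q t ` H. x \<bullet> tilt_normal H w q t = 0}"
    by (simp add: tilt_normal_orthogonal)
qed

text \<open>Slice \<open>H\<close> along \<open>w\<close> and the tilted subspace along its new normal, both over the common hyperplane.
On each slice the tilt is a translation of the hyperplane, which does not affect the inner integral.\<close>

lemma nn_integral_tilt_image:
  assumes z: "tilt_normal H w q t \<noteq> 0" and f [measurable]: "f \<in> borel_measurable borel"
  shows "integral\<^sup>N (subspace_lborel (tilt w q t ` H)) f
       = ennreal (norm (tilt_normal H w q t)) * (\<integral>\<^sup>+x. f (tilt w q t x) \<partial>subspace_lborel H)"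
proof -
  let ?z = "tilt_normal H w q t" and ?p = "orth_proj H0 q"
  have w0: "w \<noteq> 0" using w by auto
  have [measurable]: "tilt w q t \<in> borel_measurable borel"
    unfolding tilt_def by measurable
  have z_mem: "?z \<in> tilt w q t ` H"
  proof -
    have "?z = 1 *\<^sub>R ?z + 0" by simp
    then show ?thesis
      unfolding tilt_image using subspace_0[OF subspace_axis_complement] by blast
  qed
  note sl = nn_integral_subspace_slices[OF subspace_tilt_image z_mem z f,
      unfolded tilt_image_complement[OF z]]
  note sl0 = nn_integral_subspace_slices[OF H w(1) w0, folded H0_def]
  have "(\<integral>\<^sup>+x. f (tilt w q t x) \<partial>subspace_lborel H)
      = (\<integral>\<^sup>+y. \<integral>\<^sup>+s. f (tilt w q t (s *\<^sub>R w + y)) \<partial>lborel \<partial>subspace_lborel H0)"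
    using sl0(1)[of "\<lambda>x. f (tilt w q t x)"] w by simp
  also have "\<dots> = (\<integral>\<^sup>+s. \<integral>\<^sup>+y. f (tilt w q t (s *\<^sub>R w + y)) \<partial>subspace_lborel H0 \<partial>lborel)"
    by (rule sl0(2)) measurable
  also have "\<dots> = (\<integral>\<^sup>+s. \<integral>\<^sup>+y. f (s *\<^sub>R ?z + y) \<partial>subspace_lborel H0 \<partial>lborel)"
  proof (rule nn_integral_cong)
    fix s :: real
    have p: "(s * t) *\<^sub>R ?p \<in> H0"
      using orth_proj_mem[OF subspace_axis_complement] subspace_axis_complement
      by (intro subspace_scale)
    have "(\<integral>\<^sup>+y. f (tilt w q t (s *\<^sub>R w + y)) \<partial>subspace_lborel H0)
        = (\<integral>\<^sup>+y. f (s *\<^sub>R ?z + (1 *\<^sub>R y + (s * t) *\<^sub>R ?p)) \<partial>subspace_lborel H0)"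
      using AE_subspace_lborel[OF subspace_axis_complement]
      by (intro nn_integral_cong_AE) (auto simp: tilt_decomp)
    also have "\<dots> = (\<integral>\<^sup>+y. f (s *\<^sub>R ?z + y) \<partial>subspace_lborel H0)"
      using nn_integral_subspace_homothety[OF subspace_axis_complement _ p, of 1 "\<lambda>y. f (s *\<^sub>R ?z + y)"]
      by simp
    finally show "(\<integral>\<^sup>+y. f (tilt w q t (s *\<^sub>R w + y)) \<partial>subspace_lborel H0)
        = (\<integral>\<^sup>+y. f (s *\<^sub>R ?z + y) \<partial>subspace_lborel H0)" .
  qed
  also have "\<dots> = (\<integral>\<^sup>+y. \<integral>\<^sup>+s. f (s *\<^sub>R ?z + y) \<partial>lborel \<partial>subspace_lborel H0)"
    by (rule sl(2)[symmetric])
  finally show ?thesis using sl(1) by simp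
qed

lemma dim_tilt_image:
  assumes z: "tilt_normal H w q t \<noteq> 0"
  shows "dim (tilt w q t ` H) = dim H"
proof (rule dim_image_eq[OF linear_tilt])
  have ww: "w \<bullet> w = 1" using w by (simp add: norm_eq_1)
  have "x = 0" if x: "x \<in> H" "tilt w q t x = 0" for x
  proof -
    let ?y = "x - (x \<bullet> w) *\<^sub>R w"
    have y: "?y \<in> H0"
      using x w H ww by (auto simp: H0_def inner_diff_left intro!: subspace_diff subspace_scale)
    have eq: "(x \<bullet> w) *\<^sub>R tilt_normal H w q t + (?y + ((x \<bullet> w) * t) *\<^sub>R orth_proj H0 q) = 0"
      using tilt_decomp[OF y, of t "x \<bullet> w"] x by simp
    have "?y + ((x \<bullet> w) * t) *\<^sub>R orth_proj H0 q \<in> H0"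
      using y orth_proj_mem[OF subspace_axis_complement] subspace_axis_complement
      by (intro subspace_add subspace_scale)
    from tilt_normal_orthogonal[OF this, of t] arg_cong[OF eq, of "\<lambda>u. u \<bullet> tilt_normal H w q t"]
    have xw: "x \<bullet> w = 0" using z by (simp add: inner_left_distrib)
    with eq show "x = 0" by simp
  qed
  then show "inj_on (tilt w q t) (span H)"
    using linear_injective_on_subspace_0[OF linear_tilt H, of w q t] H
    by (simp add: span_eq_iff[THEN iffD2, OF H])
qed

lemma orth_proj_tilt_image:
  assumes z: "tilt_normal H w q t \<noteq> 0"
  shows "orth_proj (tilt w q t ` H) x = orth_proj H0 x
      + ((x \<bullet> tilt_normal H w q t) / (tilt_normal H w q t \<bullet> tilt_normal H w q t)) *\<^sub>R tilt_normal H w q t"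
    (is "_ = _ + ?a *\<^sub>R ?z")
proof (rule orth_proj_eqI[OF subspace_tilt_image])
  show "orth_proj H0 x + ?a *\<^sub>R ?z \<in> tilt w q t ` H"
    unfolding tilt_image using orth_proj_mem[OF subspace_axis_complement, of x]
    by (auto intro!: exI[of _ ?a] exI[of _ "orth_proj H0 x"])
next
  fix u assume "u \<in> tilt w q t ` H"
  then obtain s y where u: "y \<in> H0" "u = s *\<^sub>R ?z + y" unfolding tilt_image by blast
  have 1: "x \<bullet> y = orth_proj H0 x \<bullet> y"
    using orth_proj_residual[OF subspace_axis_complement u(1), of x] by (simp add: inner_diff_left)
  have 2: "?z \<bullet> y = 0" "y \<bullet> ?z = 0" "orth_proj H0 x \<bullet> ?z = 0"
    using tilt_normal_orthogonal[of y t] u(1)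
      tilt_normal_orthogonal[OF orth_proj_mem[OF subspace_axis_complement], of x t]
    by (simp_all add: inner_commute)
  have 3: "?a * (?z \<bullet> ?z) = x \<bullet> ?z" using z by simp
  show "(x - (orth_proj H0 x + ?a *\<^sub>R ?z)) \<bullet> u = 0"
    unfolding u(2) using 1 2 3
    by (simp add: inner_diff_left inner_left_distrib inner_right_distrib del: divide_eq_eq eq_divide_eq)
qed

lemma eventually_tilt_normal_nonzero: "\<forall>\<^sub>F t in at 0. tilt_normal H w q t \<noteq> 0"
proof -
  have "((\<lambda>t. tilt_normal H w q t) \<longlongrightarrow> tilt_normal H w q 0) (at 0)"
    unfolding tilt_normal_def by (intro tendsto_intros)
  moreover have "tilt_normal H w q 0 \<noteq> 0"
    using w by (auto simp: tilt_normal_def)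
  ultimately show ?thesis by (rule tendsto_imp_eventually_ne)
qed

text \<open>Convergence in the topology of the Grassmannian: by \<open>orth_proj_tilt_image\<close> the projection matrix is an
explicit expression in the new normal, which is affine in \<open>t\<close>.\<close>

lemma tendsto_matrix_orth_proj_tilt:
  "((\<lambda>t. matrix (orth_proj (tilt w q t ` H))) \<longlongrightarrow> matrix (orth_proj H)) (at 0)"
proof (intro vec_tendstoI)
  fix i j
  let ?z = "tilt_normal H w q"
  define e :: "real ^ 'n" where "e = axis j 1"
  define g where "g t = (orth_proj H0 e + ((e \<bullet> ?z t) / (?z t \<bullet> ?z t)) *\<^sub>R ?z t) $ i" for t
  have z: "(?z \<longlongrightarrow> ?z 0) (at 0)"
    unfolding tilt_normal_def by (intro tendsto_intros)
  have z0: "?z 0 \<noteq> 0" using w by (auto simp: tilt_normal_def)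
  then have "(g \<longlongrightarrow> g 0) (at 0)"
    unfolding g_def by (intro tendsto_intros z) auto
  moreover have "g 0 = matrix (orth_proj H) $ i $ j"
  proof -
    have "tilt w q 0 ` H = H" by (auto simp: tilt_def)
    with orth_proj_tilt_image[OF z0, of e] show ?thesis
      by (simp add: matrix_def g_def e_def)
  qed
  moreover have "\<forall>\<^sub>F t in at 0. g t = matrix (orth_proj (tilt w q t ` H)) $ i $ j"
    using eventually_tilt_normal_nonzero
    by eventually_elim (simp add: matrix_def g_def e_def orth_proj_tilt_image)
  ultimately show "((\<lambda>t. matrix (orth_proj (tilt w q t ` H)) $ i $ j)
      \<longlongrightarrow> matrix (orth_proj H) $ i $ j) (at 0)"
    by (simp add: filterlim_cong)
qed

lemma vol_tilted_section:
  assumes z: "tilt_normal H w q t \<noteq> 0"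
  shows "vol (dim H) (cube_section (tilt w q t ` H)) = norm (tilt_normal H w q t) *
      measure (subspace_lborel H) {x \<in> H. \<forall>j. \<bar>tilt w q t x $ j\<bar> \<le> 1}"
proof -
  let ?H = "tilt w q t ` H"
  have [measurable]: "tilt w q t \<in> borel_measurable borel"
    unfolding tilt_def by measurable
  have [measurable]: "cube_section ?H \<in> sets borel"
    by (intro borel_closed closed_cube_section subspace_tilt_image)
  note [measurable] = closed_subspace_borel[OF H]
  have "?H \<in> grassmannian (dim H)"
    using subspace_tilt_image dim_tilt_image[OF z] by (simp add: grassmannian_def)
  from vol_cube_section[OF this]
  have "vol (dim H) (cube_section ?H) = enn2real (\<integral>\<^sup>+x. indicator (cube_section ?H) x \<partial>subspace_lborel ?H)"
    by (simp add: measure_def)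
  also have "\<dots> = enn2real (ennreal (norm (tilt_normal H w q t)) *
      (\<integral>\<^sup>+x. indicator (cube_section ?H) (tilt w q t x) \<partial>subspace_lborel H))"
    by (subst nn_integral_tilt_image[OF z]) auto
  also have "(\<integral>\<^sup>+x. indicator (cube_section ?H) (tilt w q t x) \<partial>subspace_lborel H)
      = (\<integral>\<^sup>+x. indicator {x \<in> H. \<forall>j. \<bar>tilt w q t x $ j\<bar> \<le> 1} x \<partial>subspace_lborel H)"
    using AE_subspace_lborel[OF H]
    by (intro nn_integral_cong_AE) (auto simp: indicator_def cube_section_eq)
  also have "\<dots> = emeasure (subspace_lborel H) {x \<in> H. \<forall>j. \<bar>tilt w q t x $ j\<bar> \<le> 1}"
    by (rule nn_integral_indicator) measurable
  finally show ?thesis by (simp add: enn2real_mult measure_def)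
qed

lemma local_maximizer_tilt:
  assumes k: "dim H = k"
    and max: "local_maximizer (grassmannian_topology k) (\<lambda>H'. vol k (cube_section H')) H"
  shows "\<forall>\<^sub>F t in at 0. norm (tilt_normal H w q t) *
      measure (subspace_lborel H) {x \<in> H. \<forall>j. \<bar>tilt w q t x $ j\<bar> \<le> 1}
      \<le> measure (subspace_lborel H) (cube_section H)"
proof -
  obtain U where U: "openin (grassmannian_topology k) U" "H \<in> U"
    and le: "\<And>H'. H' \<in> U \<Longrightarrow> vol k (cube_section H') \<le> vol k (cube_section H)"
    using max by (auto simp: local_maximizer_def)
  obtain W where W: "open W" "U = (\<lambda>H. matrix (orth_proj H)) -` W \<inter> grassmannian k"
    using U(1) by (auto simp: grassmannian_topology_def openin_pullback_topology)
  have "\<forall>\<^sub>F t in at 0. matrix (orth_proj (tilt w q t ` H)) \<in> W"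
    using U(2) W by (intro topological_tendstoD[OF tendsto_matrix_orth_proj_tilt]) auto
  with eventually_tilt_normal_nonzero show ?thesis
  proof eventually_elim
    case (elim t)
    have "tilt w q t ` H \<in> grassmannian k"
      using subspace_tilt_image dim_tilt_image[OF elim(1)] k by (simp add: grassmannian_def)
    with elim(2) have "tilt w q t ` H \<in> U" by (simp add: W)
    from le[OF this] show ?case
      using vol_tilted_section[OF elim(1)] vol_cube_section[of H k] H k
      by (simp add: grassmannian_def)
  qed
qed

end

section \<open>Moving a pair of parallel facet hyperplanes\<close>

lemma initial_length_diff:
  fixes T :: "real set"
  assumes T [measurable]: "T \<in> sets borel" and \<tau>: "0 \<le> \<tau>1" "\<tau>1 \<le> \<tau>2"
  shows "measure lborel ({0..\<tau>2} \<inter> T) - measure lborel ({0..\<tau>1} \<inter> T) = measure lborel ({\<tau>1<..\<tau>2} \<inter> T)"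
proof -
  have "emeasure lborel ({0..\<tau>2} \<inter> T) \<le> emeasure lborel {0..\<tau>2}"
    by (rule emeasure_mono) auto
  also have "\<dots> < \<infinity>" using \<tau> by simp
  finally have "measure lborel ({0..\<tau>2} \<inter> T - {0..\<tau>1} \<inter> T)
      = measure lborel ({0..\<tau>2} \<inter> T) - measure lborel ({0..\<tau>1} \<inter> T)"
    using \<tau> by (intro measure_Diff) auto
  also have "{0..\<tau>2} \<inter> T - {0..\<tau>1} \<inter> T = {\<tau>1<..\<tau>2} \<inter> T"
    using \<tau> by auto
  finally show ?thesis by simp
qed

lemma initial_length_lipschitz:
  fixes T :: "real set"
  assumes T: "T \<in> sets borel" and \<tau>: "0 \<le> \<tau>1" "0 \<le> \<tau>2"
  shows "\<bar>measure lborel ({0..\<tau>2} \<inter> T) - measure lborel ({0..\<tau>1} \<inter> T)\<bar> \<le> \<bar>\<tau>2 - \<tau>1\<bar>"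
proof -
  have *: "\<bar>measure lborel ({0..b} \<inter> T) - measure lborel ({0..a} \<inter> T)\<bar> \<le> b - a"
    if "0 \<le> a" "a \<le> b" for a b :: real
  proof -
    have "measure lborel ({a<..b} \<inter> T) \<le> measure lborel {a<..b}"
      using T that by (intro measure_mono_fmeasurable) (auto simp: fmeasurable_def)
    then show ?thesis
      using that by (simp add: initial_length_diff[OF T])
  qed
  show ?thesis
  proof (cases "\<tau>1 \<le> \<tau>2")
    case True
    with *[of \<tau>1 \<tau>2] \<tau> show ?thesis by linarith
  next
    case False
    with *[of \<tau>2 \<tau>1] \<tau> show ?thesis by linarith
  qed
qed

text \<open>The derivative exists at \<open>a\<close> as soon as membership in \<open>T\<close> is constant near \<open>a\<close>; this is the
one-dimensional situation on almost every line that crosses the facet hyperplane.\<close>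

lemma initial_length_derivative:
  fixes T :: "real set"
  assumes T: "T \<in> sets borel" and a: "a > 0" and loc: "\<forall>\<^sub>F s in nhds a. s \<in> T \<longleftrightarrow> p"
  shows "((\<lambda>\<tau>. measure lborel ({0..\<tau>} \<inter> T)) has_real_derivative of_bool p) (at a)"
proof -
  obtain e where e: "e > 0" "\<And>s. dist s a < e \<Longrightarrow> s \<in> T \<longleftrightarrow> p"
    using loc unfolding eventually_nhds_metric by blast
  define d where "d = min e a"
  have d: "d > 0" "d \<le> a" using e a by (auto simp: d_def)
  let ?\<phi> = "\<lambda>\<tau>. measure lborel ({0..\<tau>} \<inter> T)"
  have piece: "measure lborel ({x<..y} \<inter> T) = of_bool p * (y - x)"
    if "a - d < x" "x \<le> y" "y < a + d" for x y
  proof -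
    have "{x<..y} \<inter> T = (if p then {x<..y} else {})"
    proof -
      have "s \<in> T \<longleftrightarrow> p" if s: "s \<in> {x<..y}" for s
      proof (rule e(2))
        have "\<bar>s - a\<bar> < d" using s \<open>a - d < x\<close> \<open>y < a + d\<close> by (simp add: abs_less_iff)
        then show "dist s a < e" by (simp add: dist_real_def d_def)
      qed
      then show ?thesis by auto
    qed
    then show ?thesis using that by simp
  qed
  have lin: "?\<phi> \<tau> = ?\<phi> a + of_bool p * (\<tau> - a)" if "\<tau> \<in> {a - d<..<a + d}" for \<tau>
  proof (cases "a \<le> \<tau>")
    case True
    then show ?thesis
      using initial_length_diff[OF T, of a \<tau>] piece[of a \<tau>] that a d(1) by simp
  next
    case False
    then show ?thesis
      using initial_length_diff[OF T, of \<tau> a] piece[of \<tau> a] that a d by (simp add: right_diff_distrib)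
  qed
  have "((\<lambda>\<tau>. ?\<phi> a + of_bool p * (\<tau> - a)) has_real_derivative of_bool p) (at a)"
    by (rule derivative_eq_intros refl | simp)+
  then show ?thesis
  proof (rule has_field_derivative_transform_within_open)
    show "open {a - d<..<a + d}" by (rule open_greaterThanLessThan)
    show "a \<in> {a - d<..<a + d}" using d by simp
    show "?\<phi> a + of_bool p * (\<tau> - a) = ?\<phi> \<tau>" if "\<tau> \<in> {a - d<..<a + d}" for \<tau>
      by (rule lin[OF that, symmetric])
  qed
qed

lemma emeasure_symmetric_halves:
  fixes V :: "'a::euclidean_space set"
  assumes V: "subspace V" and a: "a \<in> V" "a \<noteq> 0"
    and S [measurable]: "S \<in> sets borel" and sym: "\<And>x. x \<in> S \<Longrightarrow> - x \<in> S"
  shows "emeasure (subspace_lborel V) S = 2 * emeasure (subspace_lborel V) (S \<inter> {x. 0 \<le> x \<bullet> a})"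
proof -
  let ?\<mu> = "emeasure (subspace_lborel V)"
  have "?\<mu> (S \<inter> {x. x \<bullet> a < 0}) = ?\<mu> {x. (-1) *\<^sub>R x + 0 \<in> S \<inter> {x. x \<bullet> a < 0}}"
    using emeasure_subspace_homothety[OF V _ subspace_0[OF V], of "-1" "S \<inter> {x. x \<bullet> a < 0}"] by simp
  also have "{x. (-1) *\<^sub>R x + 0 \<in> S \<inter> {x. x \<bullet> a < 0}} = S \<inter> {x. 0 < x \<bullet> a}"
    using sym by force
  also have "?\<mu> (S \<inter> {x. 0 < x \<bullet> a}) = ?\<mu> (S \<inter> {x. 0 \<le> x \<bullet> a})"
  proof (rule emeasure_eq_AE)
    have "AE x in subspace_lborel V. x \<notin> {x. x \<bullet> a = 0}"
      by (rule AE_not_in) (simp add: null_sets_def emeasure_subspace_hyperplane[OF V a])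
    then show "AE x in subspace_lborel V. x \<in> S \<inter> {x. 0 < x \<bullet> a} \<longleftrightarrow> x \<in> S \<inter> {x. 0 \<le> x \<bullet> a}"
      by eventually_elim auto
  qed measurable
  finally have neg: "?\<mu> (S \<inter> {x. x \<bullet> a < 0}) = ?\<mu> (S \<inter> {x. 0 \<le> x \<bullet> a})" .
  have "?\<mu> S = ?\<mu> ((S \<inter> {x. 0 \<le> x \<bullet> a}) \<union> (S \<inter> {x. x \<bullet> a < 0}))"
    by (rule arg_cong[of _ _ ?\<mu>]) auto
  also have "\<dots> = ?\<mu> (S \<inter> {x. 0 \<le> x \<bullet> a}) + ?\<mu> (S \<inter> {x. x \<bullet> a < 0})"
    by (rule plus_emeasure[symmetric]) auto
  finally show ?thesis by (simp add: neg mult_2)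
qed

text \<open>If \<open>u\<close> is not a multiple of \<open>g\<close>, the exceptional points lie in two hyperplanes of the slice. If
\<open>u\<close> is a multiple, the inner product is constant on the slice, and it is not \<open>1\<close> or \<open>- 1\<close> because
\<open>u\<close> is neither \<open>g\<close> nor \<open>- g\<close>.\<close>

lemma AE_facet_transversal:
  fixes H :: "'a::euclidean_space set" and g u :: 'a
  assumes H: "subspace H" and g: "g \<in> H" "g \<noteq> 0" and u: "u \<in> H" "u \<noteq> g" "u \<noteq> - g"
  shows "AE y in subspace_lborel {x \<in> H. x \<bullet> g = 0}. \<bar>(g /\<^sub>R (g \<bullet> g) + y) \<bullet> u\<bar> \<noteq> 1"
proof -
  let ?W = "{x \<in> H. x \<bullet> g = 0}"
  have W: "subspace ?W" by (rule subspace_orthogonal_section[OF H])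
  define r where "r = (u \<bullet> g) / (g \<bullet> g)"
  define p where "p = u - r *\<^sub>R g"
  have p: "p \<in> ?W"
    using u g H by (auto simp: p_def r_def inner_diff_left intro!: subspace_diff subspace_scale)
  have val: "(g /\<^sub>R (g \<bullet> g) + y) \<bullet> u = r + y \<bullet> p" if "y \<in> ?W" for y
    using that
    by (simp add: p_def r_def inner_left_distrib inner_diff_right inner_commute[of g u]
        divide_inverse mult.commute)
  show ?thesis
  proof (cases "p = 0")
    case True
    then have ur: "u = r *\<^sub>R g" by (simp add: p_def)
    have r: "\<bar>r\<bar> \<noteq> 1"
    proof
      assume "\<bar>r\<bar> = 1"
      then have "r = 1 \<or> r = - 1" by linarith
      with ur u show False by auto
    qed
    show ?thesis
      using AE_subspace_lborel[OF W] by eventually_elim (simp add: val True r)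
  next
    case False
    have "AE y in subspace_lborel ?W. y \<notin> {x. x \<bullet> p = d}" for d
      by (rule AE_not_in) (simp add: null_sets_def emeasure_subspace_hyperplane[OF W p False])
    from this[of "1 - r"] this[of "- 1 - r"] AE_subspace_lborel[OF W]
    show ?thesis
    proof eventually_elim
      case (elim y)
      then show ?case using val[of y] by auto
    qed
  qed
qed

text \<open>Cut the body into lines \<open>s \<mapsto> s c + y\<close> with \<open>c = g / \<bar>g\<bar>\<^sup>2\<close> and \<open>y \<bullet> g = 0\<close>, so that \<open>s\<close> is the value of
\<open>x \<bullet> g\<close>. By central symmetry the half \<open>s \<ge> 0\<close> suffices. On it the moving slab is, for small \<open>t\<close>, the
constraint \<open>s \<le> \<sigma> t y\<close>, and the endpoint \<open>\<sigma> t y\<close> moves at speed \<open>- ((c + y) \<bullet> w)\<close> when \<open>t = 0\<close>. Almost every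
line either crosses the face \<open>s = 1\<close> in the interior of the other constraints or misses it by a
positive distance, so the length of the line inside the body is differentiable in \<open>t\<close>. It is also
Lipschitz in \<open>t\<close> uniformly over the bounded range of \<open>y\<close>, and dominated convergence applies.
That \<open>R\<close> does not depend on \<open>t\<close> is what provides the integrable majorant.\<close>

lemma slab_volume_derivative:
  fixes H :: "'a::euclidean_space set" and g w :: 'a and v :: "'i \<Rightarrow> 'a"
  assumes H: "subspace H" and g: "g \<in> H" "g \<noteq> 0"
    and J: "finite J" and v: "\<And>j. j \<in> J \<Longrightarrow> v j \<in> H" "\<And>j. j \<in> J \<Longrightarrow> v j \<noteq> g" "\<And>j. j \<in> J \<Longrightarrow> v j \<noteq> - g"
    and \<delta>: "\<delta> > 0"
    and bd: "\<And>t x. \<bar>t\<bar> \<le> \<delta> \<Longrightarrow> x \<in> H \<Longrightarrow> (\<forall>j\<in>J. \<bar>x \<bullet> v j\<bar> \<le> 1) \<Longrightarrow> \<bar>x \<bullet> g + t * (x \<bullet> w)\<bar> \<le> 1 \<Longrightarrow> norm x \<le> R"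
  shows "((\<lambda>t. measure (subspace_lborel H)
             {x \<in> H. (\<forall>j\<in>J. \<bar>x \<bullet> v j\<bar> \<le> 1) \<and> \<bar>x \<bullet> g + t * (x \<bullet> w)\<bar> \<le> 1})
           has_real_derivative
           - (2 / norm g * (LINT y|subspace_lborel {x \<in> H. x \<bullet> g = 0}.
               indicator {x. \<forall>j\<in>J. \<bar>x \<bullet> v j\<bar> \<le> 1} (g /\<^sub>R (g \<bullet> g) + y)
                 * ((g /\<^sub>R (g \<bullet> g) + y) \<bullet> w)))) (at 0)"
proof -
  define c where "c = g /\<^sub>R (g \<bullet> g)"
  define W where "W = {x \<in> H. x \<bullet> g = 0}"
  define Q where "Q = {x. \<forall>j\<in>J. \<bar>x \<bullet> v j\<bar> \<le> 1}"
  define C where "C t = {x \<in> H. (\<forall>j\<in>J. \<bar>x \<bullet> v j\<bar> \<le> 1) \<and> \<bar>x \<bullet> g + t * (x \<bullet> w)\<bar> \<le> 1}" for t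
  define \<mu> where "\<mu> = subspace_lborel W"
  define M where "M t = measure (subspace_lborel H) (C t)" for t
  define a where "a = c \<bullet> w"
  have W: "subspace W" unfolding W_def by (rule subspace_orthogonal_section[OF H])
  have gg: "g \<bullet> g > 0" using g by simp
  have c: "c \<in> H" "c \<noteq> 0" "c \<bullet> g = 1" "norm c = 1 / norm g"
    using g H by (auto simp: c_def subspace_scale norm_eq_sqrt_inner real_sqrt_mult
        divide_simps real_sqrt_divide)
  have Wc: "{x \<in> H. x \<bullet> c = 0} = W"
    using gg by (auto simp: W_def c_def)
  have [measurable]: "Q \<in> sets borel"
  proof -
    have "Q = (\<Inter>j\<in>J. {x. \<bar>x \<bullet> v j\<bar> \<le> 1})" by (auto simp: Q_def)
    moreover have "closed {x. \<bar>x \<bullet> v j\<bar> \<le> 1}" for j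
      by (intro closed_Collect_le continuous_intros)
    ultimately show ?thesis by (intro borel_closed) (simp only:, intro closed_INT ballI)
  qed
  note [measurable] = closed_subspace_borel[OF H] closed_subspace_borel[OF W]
  have C_eq: "C t = H \<inter> Q \<inter> {x. \<bar>x \<bullet> g + t * (x \<bullet> w)\<bar> \<le> 1}" for t
    by (auto simp: C_def Q_def)
  have [measurable]: "C t \<in> sets borel" for t unfolding C_eq by measurable
  have sets_\<mu> [measurable_cong]: "sets \<mu> = sets borel" by (simp add: \<mu>_def)
  have space_\<mu> [simp]: "space \<mu> = UNIV" by (simp add: \<mu>_def)
  have in_W: "AE y in \<mu>. y \<in> W" unfolding \<mu>_def by (rule AE_subspace_lborel[OF W])

  \<comment> \<open>the parameter at which the moving hyperplane meets the line through y\<close>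
  define \<sigma> where "\<sigma> t y = (1 - t * (y \<bullet> w)) / (1 + t * a)" for t y
  define T where "T y = {s. s *\<^sub>R c + y \<in> Q}" for y
  define \<phi> where "\<phi> y \<tau> = measure lborel ({0..\<tau>} \<inter> T y)" for y \<tau>
  define h where "h t y = indicator (cball 0 R) y * \<phi> y (\<sigma> t y)" for t y
  have [measurable]: "cball (0::'a) R \<in> sets borel" by (rule borel_closed) simp
  have T_meas: "T y \<in> sets borel" for y unfolding T_def by measurable
  have R: "R \<ge> 0"
    using bd[of 0 0] \<delta> subspace_0[OF H] by simp
  define K where "K = \<bar>a\<bar> + R * norm w"
  have K: "K \<ge> 0" using R by (simp add: K_def)
  \<comment> \<open>for \<open>\<bar>t\<bar> \<le> \<eta>\<close> and \<open>norm y \<le> R\<close> both \<open>\<bar>t a\<bar>\<close> and \<open>\<bar>t (y \<bullet> w)\<bar>\<close> are at most \<open>1/2\<close>, so the far side of the slab is not active for \<open>s \<ge> 0\<close>\<close>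
  define \<eta> where "\<eta> = min \<delta> (1 / (2 * (K + 1)))"
  have \<eta>: "\<eta> > 0" "\<eta> \<le> \<delta>" using \<delta> K by (auto simp: \<eta>_def)
  have \<eta>K: "\<eta> * K \<le> 1 / 2"
  proof -
    have "\<eta> * K \<le> (1 / (2 * (K + 1))) * K" using K by (intro mult_right_mono) (auto simp: \<eta>_def)
    also have "\<dots> \<le> 1 / 2" using K by (simp add: divide_simps)
    finally show ?thesis .
  qed
  have small: "\<bar>t * a\<bar> \<le> 1 / 2" "\<bar>t * (y \<bullet> w)\<bar> \<le> 1 / 2" "\<bar>a + y \<bullet> w\<bar> \<le> K"
    if t: "\<bar>t\<bar> \<le> \<eta>" and y: "norm y \<le> R" for t y
  proof -
    have yw: "\<bar>y \<bullet> w\<bar> \<le> R * norm w"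
      using Cauchy_Schwarz_ineq2[of y w] mult_right_mono[OF y, of "norm w"] by simp
    have le: "\<bar>a\<bar> \<le> K" "\<bar>y \<bullet> w\<bar> \<le> K" using yw R by (auto simp: K_def)
    show "\<bar>a + y \<bullet> w\<bar> \<le> K" using yw by (simp add: K_def)
    have "\<bar>t\<bar> * \<bar>a\<bar> \<le> \<eta> * K" "\<bar>t\<bar> * \<bar>y \<bullet> w\<bar> \<le> \<eta> * K"
      using t le \<eta> by (auto intro!: mult_mono)
    then show "\<bar>t * a\<bar> \<le> 1 / 2" "\<bar>t * (y \<bullet> w)\<bar> \<le> 1 / 2"
      using \<eta>K by (auto simp: abs_mult)
  qed
  have mem_line: "s *\<^sub>R c + y \<in> C t \<and> 0 \<le> s \<longleftrightarrow> norm y \<le> R \<and> s \<in> {0..\<sigma> t y} \<inter> T y"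
    if y: "y \<in> W" and t: "\<bar>t\<bar> \<le> \<eta>" for s t y
  proof -
    have yc: "y \<bullet> c = 0" "y \<bullet> g = 0" "y \<in> H" using y Wc by (auto simp: W_def)
    have H_mem: "s *\<^sub>R c + y \<in> H" using c yc H by (intro subspace_add subspace_scale)
    have gx: "(s *\<^sub>R c + y) \<bullet> g = s" using c yc by (simp add: inner_left_distrib)
    have wx: "(s *\<^sub>R c + y) \<bullet> w = s * a + y \<bullet> w" by (simp add: a_def inner_left_distrib)
    have slab: "\<bar>s + t * (s * a + y \<bullet> w)\<bar> \<le> 1 \<longleftrightarrow> s \<le> \<sigma> t y" if "norm y \<le> R" "0 \<le> s"
    proof -
      note sm = small[OF t that(1)]
      have pos: "1 + t * a > 0" using sm(1) by linarith
      have "s + t * (s * a + y \<bullet> w) = s * (1 + t * a) + t * (y \<bullet> w)" by (simp add: algebra_simps)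
      moreover have "s * (1 + t * a) \<ge> 0" using pos that by simp
      ultimately have "\<bar>s + t * (s * a + y \<bullet> w)\<bar> \<le> 1 \<longleftrightarrow> s * (1 + t * a) \<le> 1 - t * (y \<bullet> w)"
        using sm(2) by (auto simp: abs_le_iff)
      also have "\<dots> \<longleftrightarrow> s \<le> \<sigma> t y" using pos by (simp add: \<sigma>_def pos_le_divide_eq)
      finally show ?thesis .
    qed
    have "norm y \<le> R" if "s *\<^sub>R c + y \<in> C t"
    proof -
      have "norm (s *\<^sub>R c + y) \<le> R"
        using bd[of t "s *\<^sub>R c + y"] that t \<eta> by (auto simp: C_def)
      moreover have "(norm y)\<^sup>2 = (s *\<^sub>R c + y) \<bullet> y"
        using yc by (simp add: inner_left_distrib inner_commute[of c y] power2_norm_eq_inner)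
      then have "norm y * norm y \<le> norm (s *\<^sub>R c + y) * norm y"
        using norm_cauchy_schwarz[of "s *\<^sub>R c + y" y] by (simp add: power2_eq_square)
      then have "norm y \<le> norm (s *\<^sub>R c + y)"
        by (cases "y = 0") (auto simp: mult_le_cancel_right)
      ultimately show ?thesis by linarith
    qed
    then show ?thesis
      using slab H_mem gx wx by (auto simp: C_eq T_def)
  qed
  have \<phi>_meas: "(\<lambda>y. \<phi> y (f y)) \<in> borel_measurable borel" if [measurable]: "f \<in> borel_measurable borel" for f
  proof -
    have "\<phi> y (f y) = enn2real (\<integral>\<^sup>+s. indicator {0..f y} s * indicator Q (s *\<^sub>R c + y) \<partial>lborel)" for y
    proof -
      have "(\<integral>\<^sup>+s. indicator {0..f y} s * indicator Q (s *\<^sub>R c + y) \<partial>lborel)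
          = (\<integral>\<^sup>+s. indicator ({0..f y} \<inter> T y) s \<partial>lborel)"
        by (intro nn_integral_cong) (auto simp: T_def indicator_def)
      also have "\<dots> = emeasure lborel ({0..f y} \<inter> T y)"
        using T_meas by (intro nn_integral_indicator) auto
      finally show ?thesis by (simp add: \<phi>_def measure_def)
    qed
    moreover have "(\<lambda>y. enn2real (\<integral>\<^sup>+s. indicator {0..f y} s * indicator Q (s *\<^sub>R c + y) \<partial>lborel)) \<in> borel_measurable borel"
      by (simp only: indicator_def[abs_def] atLeastAtMost_iff of_bool_def) measurable
    ultimately show ?thesis by simp
  qed
  have h_meas [measurable]: "h t \<in> borel_measurable borel" for t
  proof -
    have "(\<lambda>y. \<phi> y (\<sigma> t y)) \<in> borel_measurable borel"
      by (rule \<phi>_meas) (unfold \<sigma>_def, measurable)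
    then show ?thesis
      unfolding h_def by (intro borel_measurable_times borel_measurable_indicator) auto
  qed
  have h_nonneg: "h t y \<ge> 0" for t y by (simp add: h_def \<phi>_def)

  have M_eq: "M t = 2 / norm g * (\<integral>y. h t y \<partial>\<mu>)" if t: "\<bar>t\<bar> \<le> \<eta>" for t
  proof -
    let ?S = "C t \<inter> {x. 0 \<le> x \<bullet> g}"
    have sym: "- x \<in> C t" if x: "x \<in> C t" for x
    proof -
      have "(- x) \<bullet> g + t * ((- x) \<bullet> w) = - (x \<bullet> g + t * (x \<bullet> w))" by simp
      then show ?thesis using x H unfolding C_def by (auto simp: subspace_neg simp del: minus_add_distrib)
    qed
    have "emeasure (subspace_lborel H) ?S = (\<integral>\<^sup>+x. indicator ?S x \<partial>subspace_lborel H)"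
      by simp
    also have "\<dots> = ennreal (norm c) * (\<integral>\<^sup>+y. \<integral>\<^sup>+s. indicator ?S (s *\<^sub>R c + y) \<partial>lborel \<partial>\<mu>)"
      unfolding \<mu>_def Wc[symmetric] by (rule nn_integral_subspace_slices(1)[OF H c(1,2)]) measurable
    also have "(\<integral>\<^sup>+y. \<integral>\<^sup>+s. indicator ?S (s *\<^sub>R c + y) \<partial>lborel \<partial>\<mu>) = (\<integral>\<^sup>+y. ennreal (h t y) \<partial>\<mu>)"
    proof (rule nn_integral_cong_AE, use in_W in eventually_elim)
      fix y assume y: "y \<in> W"
      then have gx: "(s *\<^sub>R c + y) \<bullet> g = s" for s
        using c by (simp add: W_def inner_left_distrib)
      have "(\<integral>\<^sup>+s. indicator ?S (s *\<^sub>R c + y) \<partial>lborel)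
          = (\<integral>\<^sup>+s. indicator (cball 0 R) y * indicator ({0..\<sigma> t y} \<inter> T y) s \<partial>lborel)"
      proof (rule nn_integral_cong)
        fix s :: real
        have "s *\<^sub>R c + y \<in> ?S \<longleftrightarrow> s *\<^sub>R c + y \<in> C t \<and> 0 \<le> s" using gx by simp
        then show "(indicator ?S (s *\<^sub>R c + y) :: ennreal)
            = indicator (cball 0 R) y * indicator ({0..\<sigma> t y} \<inter> T y) s"
          unfolding mem_line[OF y t] by (auto simp: indicator_def)
      qed
      also have "\<dots> = indicator (cball 0 R) y * emeasure lborel ({0..\<sigma> t y} \<inter> T y)"
        using T_meas by (subst nn_integral_cmult) auto
      also have "emeasure lborel ({0..\<sigma> t y} \<inter> T y) = ennreal (\<phi> y (\<sigma> t y))"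
      proof -
        have "emeasure lborel ({0..\<sigma> t y} \<inter> T y) \<le> emeasure lborel {0..\<sigma> t y}"
          by (rule emeasure_mono) auto
        also have "\<dots> < top" by (cases "0 \<le> \<sigma> t y") auto
        finally show ?thesis unfolding \<phi>_def by (intro emeasure_eq_ennreal_measure) auto
      qed
      finally show "(\<integral>\<^sup>+s. indicator ?S (s *\<^sub>R c + y) \<partial>lborel) = ennreal (h t y)"
        by (simp add: h_def indicator_def)
    qed
    finally have "emeasure (subspace_lborel H) ?S = ennreal (norm c) * (\<integral>\<^sup>+y. ennreal (h t y) \<partial>\<mu>)" .
    then have "M t = enn2real (2 * (ennreal (norm c) * (\<integral>\<^sup>+y. ennreal (h t y) \<partial>\<mu>)))"
      unfolding M_def measure_def using emeasure_symmetric_halves[OF H g, of "C t"] sym by simp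
    also have "\<dots> = 2 * (norm c * enn2real (\<integral>\<^sup>+y. ennreal (h t y) \<partial>\<mu>))"
      by (simp add: enn2real_mult)
    also have "enn2real (\<integral>\<^sup>+y. ennreal (h t y) \<partial>\<mu>) = (\<integral>y. h t y \<partial>\<mu>)"
      by (rule integral_eq_nn_integral[symmetric]) (auto simp: h_nonneg)
    finally show ?thesis by (simp add: c(4))
  qed

  have \<sigma>_pos: "\<sigma> t y \<ge> 0" and \<sigma>_close: "\<bar>\<sigma> t y - 1\<bar> \<le> 2 * K * \<bar>t\<bar>"
    if t: "\<bar>t\<bar> \<le> \<eta>" and y: "norm y \<le> R" for t y
  proof -
    note sm = small[OF t y]
    have pos: "1 + t * a \<ge> 1 / 2" using sm(1) by linarith
    then show "\<sigma> t y \<ge> 0" using sm(2) by (auto simp: \<sigma>_def intro!: divide_nonneg_pos)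
    have "\<sigma> t y - 1 = - (t * (a + y \<bullet> w)) / (1 + t * a)"
      using pos by (simp add: \<sigma>_def field_simps)
    then have "\<bar>\<sigma> t y - 1\<bar> = \<bar>t\<bar> * \<bar>a + y \<bullet> w\<bar> / (1 + t * a)"
      using pos by (simp add: abs_mult)
    also have "\<dots> \<le> \<bar>t\<bar> * K / (1 / 2)"
      using pos sm(3) K by (intro frac_le mult_mono mult_nonneg_nonneg) auto
    finally show "\<bar>\<sigma> t y - 1\<bar> \<le> 2 * K * \<bar>t\<bar>" by (simp add: mult_ac)
  qed
  have \<sigma>0: "\<sigma> 0 y = 1" for y by (simp add: \<sigma>_def)
  have h_lip: "\<bar>h t y - h 0 y\<bar> \<le> indicator (cball 0 R) y * (2 * K * \<bar>t\<bar>)" if t: "\<bar>t\<bar> \<le> \<eta>" for t y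
  proof (cases "norm y \<le> R")
    case True
    have "\<bar>h t y - h 0 y\<bar> = \<bar>\<phi> y (\<sigma> t y) - \<phi> y 1\<bar>" using True by (simp add: h_def \<sigma>0)
    also have "\<dots> \<le> \<bar>\<sigma> t y - 1\<bar>"
      unfolding \<phi>_def by (rule initial_length_lipschitz[OF T_meas]) (use \<sigma>_pos[OF t True] in auto)
    also have "\<dots> \<le> 2 * K * \<bar>t\<bar>" by (rule \<sigma>_close[OF t True])
    finally show ?thesis using True by simp
  qed (simp add: h_def)

  have fin_ball: "emeasure \<mu> (cball 0 R) < \<infinity>"
    unfolding \<mu>_def by (rule emeasure_subspace_bounded_finite[OF W]) simp
  have int_ball: "integrable \<mu> (\<lambda>y. indicator (cball 0 R) y * B :: real)" for B
    using fin_ball by (intro integrable_mult_left integrable_real_indicator) auto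
  have h_int: "integrable \<mu> (h t)" if t: "\<bar>t\<bar> \<le> \<eta>" for t
  proof (rule Bochner_Integration.integrable_bound[OF int_ball[of "1 + 2 * K * \<bar>t\<bar>"]])
    show "AE y in \<mu>. norm (h t y) \<le> norm (indicator (cball 0 R) y * (1 + 2 * K * \<bar>t\<bar>))"
    proof (rule AE_I2)
      fix y
      show "norm (h t y) \<le> norm (indicator (cball 0 R) y * (1 + 2 * K * \<bar>t\<bar>))"
      proof (cases "norm y \<le> R")
        case True
        have "\<phi> y (\<sigma> t y) - \<phi> y 0 \<le> \<bar>\<sigma> t y - 0\<bar>"
          using initial_length_lipschitz[OF T_meas, of 0 "\<sigma> t y" y] \<sigma>_pos[OF t True] by (simp add: \<phi>_def)
        moreover have "\<phi> y 0 \<le> 0"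
        proof -
          have "measure lborel ({0..0} \<inter> T y) \<le> measure lborel {0::real}"
            using T_meas by (intro measure_mono_fmeasurable) (auto simp: fmeasurable_def)
          then show ?thesis by (simp add: \<phi>_def)
        qed
        ultimately have "\<phi> y (\<sigma> t y) \<le> 1 + 2 * K * \<bar>t\<bar>"
          using \<sigma>_close[OF t True] \<sigma>_pos[OF t True] by linarith
        then show ?thesis using True K h_nonneg[of t y] by (simp add: h_def)
      qed (simp add: h_def)
    qed
  qed measurable

  define D where "D y = - (indicator (cball 0 R) y * (indicator Q (c + y) * ((c + y) \<bullet> w)))" for y
  have D_meas [measurable]: "D \<in> borel_measurable borel" unfolding D_def by measurable
  have transversal: "AE y in \<mu>. \<forall>j\<in>J. \<bar>(c + y) \<bullet> v j\<bar> \<noteq> 1"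
    unfolding AE_ball_countable[OF countable_finite[OF J]] \<mu>_def W_def c_def
    using AE_facet_transversal[OF H g] v by blast
  have h_deriv: "AE y in \<mu>. ((\<lambda>t. h t y) has_real_derivative D y) (at 0)"
    using transversal
  proof eventually_elim
    case (elim y)
    have "\<forall>\<^sub>F s in nhds 1. (\<bar>(s *\<^sub>R c + y) \<bullet> v j\<bar> \<le> 1) = (\<bar>(c + y) \<bullet> v j\<bar> \<le> 1)" if j: "j \<in> J" for j
    proof -
      have lim: "((\<lambda>s. \<bar>(s *\<^sub>R c + y) \<bullet> v j\<bar>) \<longlongrightarrow> \<bar>(1 *\<^sub>R c + y) \<bullet> v j\<bar>) (nhds 1)"
        by (intro tendsto_intros filterlim_ident)
      show ?thesis
      proof (cases "\<bar>(c + y) \<bullet> v j\<bar> < 1")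
        case True
        have "\<forall>\<^sub>F s in nhds 1. \<bar>(s *\<^sub>R c + y) \<bullet> v j\<bar> < 1"
          by (rule order_tendstoD(2)[OF lim]) (use True in simp)
        then show ?thesis by eventually_elim (use True in auto)
      next
        case False
        then have gt: "\<bar>(c + y) \<bullet> v j\<bar> > 1" using elim j by force
        have "\<forall>\<^sub>F s in nhds 1. \<bar>(s *\<^sub>R c + y) \<bullet> v j\<bar> > 1"
          by (rule order_tendstoD(1)[OF lim]) (use gt in simp)
        then show ?thesis by eventually_elim (use gt in auto)
      qed
    qed
    then have "\<forall>\<^sub>F s in nhds 1. \<forall>j\<in>J. (\<bar>(s *\<^sub>R c + y) \<bullet> v j\<bar> \<le> 1) = (\<bar>(c + y) \<bullet> v j\<bar> \<le> 1)"
      by (intro eventually_ball_finite[OF J]) auto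
    then have loc: "\<forall>\<^sub>F s in nhds 1. s \<in> T y \<longleftrightarrow> c + y \<in> Q"
      by eventually_elim (auto simp: T_def Q_def)
    have d\<phi>: "(\<phi> y has_real_derivative of_bool (c + y \<in> Q)) (at (\<sigma> 0 y))"
      unfolding \<phi>_def \<sigma>0 by (rule initial_length_derivative[OF T_meas _ loc]) simp
    have d\<sigma>: "((\<lambda>t. \<sigma> t y) has_real_derivative - ((c + y) \<bullet> w)) (at 0)"
      unfolding \<sigma>_def a_def by (auto intro!: derivative_eq_intros simp: inner_left_distrib)
    have "((\<lambda>t. indicator (cball 0 R) y * \<phi> y (\<sigma> t y)) has_real_derivative
        indicator (cball 0 R) y * (of_bool (c + y \<in> Q) * - ((c + y) \<bullet> w))) (at 0)"
      by (intro DERIV_cmult DERIV_chain2[OF d\<phi> d\<sigma>])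
    then show ?case by (simp add: h_def D_def indicator_def)
  qed

  have "((\<lambda>t. (M t - M 0) / t) \<longlongrightarrow> 2 / norm g * (\<integral>y. D y \<partial>\<mu>)) (at 0)"
    unfolding tendsto_at_iff_sequentially
  proof (intro allI impI)
    fix X :: "nat \<Rightarrow> real" assume X: "\<forall>i. X i \<in> UNIV - {0}" "X \<longlonglongrightarrow> 0"
    \<comment> \<open>the value 0 occurs for finitely many n only; it makes the domination hold for every n\<close>
    define q where "q n y = (if \<bar>X n\<bar> \<le> \<eta> then (h (X n) y - h 0 y) / X n else 0)" for n y
    have ev: "\<forall>\<^sub>F n in sequentially. \<bar>X n\<bar> \<le> \<eta>"
      using order_tendstoD(2)[OF tendsto_rabs[OF X(2)], of \<eta>] \<eta> by (auto elim: eventually_mono)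
    have "(\<lambda>n. \<integral>y. q n y \<partial>\<mu>) \<longlonglongrightarrow> (\<integral>y. D y \<partial>\<mu>)"
    proof (rule integral_dominated_convergence[OF _ _ int_ball[of "2 * K"]])
      show "AE y in \<mu>. (\<lambda>n. q n y) \<longlonglongrightarrow> D y"
        using h_deriv
      proof eventually_elim
        case (elim y)
        have "((\<lambda>t. (h t y - h 0 y) / t) \<longlongrightarrow> D y) (at 0)"
          using elim by (simp add: has_field_derivative_iff)
        then have "((\<lambda>t. (h t y - h 0 y) / t) \<circ> X) \<longlonglongrightarrow> D y"
          using X unfolding tendsto_at_iff_sequentially by blast
        moreover have "\<forall>\<^sub>F n in sequentially. ((\<lambda>t. (h t y - h 0 y) / t) \<circ> X) n = q n y"
          using ev by eventually_elim (simp add: q_def)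
        ultimately show ?case by (rule Lim_transform_eventually)
      qed
      show "AE y in \<mu>. norm (q n y) \<le> indicator (cball 0 R) y * (2 * K)" for n
      proof (rule AE_I2)
        fix y
        have "X n \<noteq> 0" using X by simp
        then show "norm (q n y) \<le> indicator (cball 0 R) y * (2 * K)"
          using h_lip[of "X n" y] K by (simp add: q_def divide_simps mult_ac)
      qed
      show "q n \<in> borel_measurable \<mu>" for n unfolding q_def by measurable
    qed measurable
    then have lim: "(\<lambda>n. 2 / norm g * (\<integral>y. q n y \<partial>\<mu>)) \<longlonglongrightarrow> 2 / norm g * (\<integral>y. D y \<partial>\<mu>)"
      by (intro tendsto_intros)
    have "\<forall>\<^sub>F n in sequentially. 2 / norm g * (\<integral>y. q n y \<partial>\<mu>) = ((\<lambda>t. (M t - M 0) / t) \<circ> X) n"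
      using ev
    proof eventually_elim
      case (elim n)
      have "(\<integral>y. q n y \<partial>\<mu>) = ((\<integral>y. h (X n) y \<partial>\<mu>) - (\<integral>y. h 0 y \<partial>\<mu>)) / X n"
        using elim \<eta> h_int[of "X n"] h_int[of 0] by (simp add: q_def)
      then show ?case
        using M_eq[OF elim] M_eq[of 0] \<eta> by (simp add: diff_divide_distrib right_diff_distrib)
    qed
    with lim show "((\<lambda>t. (M t - M 0) / t) \<circ> X) \<longlonglongrightarrow> 2 / norm g * (\<integral>y. D y \<partial>\<mu>)"
      by (rule Lim_transform_eventually)
  qed
  moreover have "(\<integral>y. D y \<partial>\<mu>) = - (\<integral>y. indicator Q (c + y) * ((c + y) \<bullet> w) \<partial>\<mu>)"
  proof -
    have "(\<integral>y. D y \<partial>\<mu>) = (\<integral>y. - (indicator Q (c + y) * ((c + y) \<bullet> w)) \<partial>\<mu>)"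
    proof (rule integral_cong_AE)
      show "AE y in \<mu>. D y = - (indicator Q (c + y) * ((c + y) \<bullet> w))"
        using in_W
      proof eventually_elim
        case (elim y)
        have "y \<bullet> c = 0" "y \<bullet> g = 0" using elim Wc by (auto simp: W_def)
        then have "1 *\<^sub>R c + y \<in> C 0 \<longleftrightarrow> c + y \<in> Q"
          using elim c H by (auto simp: C_eq W_def inner_left_distrib intro!: subspace_add)
        then have "norm y \<le> R" if "c + y \<in> Q"
          using mem_line[OF elim, of 0 1] that \<eta> by auto
        then show ?case by (auto simp: D_def indicator_def)
      qed
    qed measurable
    then show ?thesis by simp
  qed
  ultimately show ?thesis
    unfolding has_field_derivative_iff M_def C_def \<mu>_def W_def c_def Q_def by simp
qed

section \<open>The first-order condition at a local maximizer\<close>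

lemma dim_orthogonal_section:
  fixes V :: "'a::euclidean_space set"
  assumes V: "subspace V" and z: "z \<in> V" "z \<noteq> 0"
  shows "dim {x \<in> V. x \<bullet> z = 0} + 1 = dim V"
proof -
  obtain B where B: "orthonormal_basis B {x \<in> V. x \<bullet> z = 0}"
    using orthonormal_basis_exists[OF subspace_orthogonal_section[OF V]] by blast
  note ins = orthonormal_basis_insert[OF V z B]
  show ?thesis
    using card_orthonormal_basis[OF B] card_orthonormal_basis[OF ins(1)]
      orthonormal_basis_finite[OF B] ins(2) by simp
qed

lemma cube_section_measure_pos:
  assumes H: "subspace H"
  shows "measure (subspace_lborel H) (cube_section H) > 0"
proof -
  have "AE x in subspace_lborel H. x \<in> ball 0 1 \<longrightarrow> x \<in> cube_section H"
    using AE_subspace_lborel[OF H]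
  proof eventually_elim
    case (elim x)
    then show ?case
      using component_le_norm_cart[of x] by (auto simp: cube_section_eq intro: order_trans less_imp_le)
  qed
  then have "emeasure (subspace_lborel H) (ball 0 1) \<le> emeasure (subspace_lborel H) (cube_section H)"
    by (rule emeasure_mono_AE) (simp add: closed_cube_section[OF H])
  with emeasure_subspace_ball_pos[OF H, of 1]
  have "emeasure (subspace_lborel H) (cube_section H) > 0" by (simp add: order_less_le_trans)
  moreover have "emeasure (subspace_lborel H) (cube_section H) < \<infinity>"
    by (rule emeasure_subspace_bounded_finite[OF H bounded_cube_section])
  ultimately show ?thesis by (simp add: measure_def enn2real_positive_iff)
qed

locale maximal_cube_section =
  fixes k :: nat and H :: "(real ^ 'n) set" and v :: "'n \<Rightarrow> real ^ 'n"
  assumes dim_pos: "2 \<le> k"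
    and subspace_H: "subspace H" and dim_H: "dim H = k"
    and maximal: "local_maximizer (grassmannian_topology k) (\<lambda>H'. vol k (cube_section H')) H"
    and v_eq: "v i = orth_proj H (axis i 1)"
begin

lemma v_mem: "v i \<in> H"
  unfolding v_eq by (rule orth_proj_mem[OF subspace_H])

lemma component_eq: "x \<in> H \<Longrightarrow> x $ i = x \<bullet> v i"
  unfolding v_eq using orth_proj_inner[OF subspace_H, of x "axis i 1"] by (simp add: inner_axis)

lemma section_eq: "cube_section H = {x \<in> H. \<forall>j. \<bar>x \<bullet> v j\<bar> \<le> 1}"
  by (auto simp: cube_section_eq component_eq)

text \<open>If \<open>v i = 0\<close> then \<open>e\<^sub>i\<close> is orthogonal to \<open>H\<close>. Tilting towards \<open>q = e\<^sub>i\<close> then leaves the polytope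
unchanged for small \<open>t\<close>, because the perturbed constraint \<open>\<bar>t (x \<bullet> w)\<bar> \<le> 1\<close> is not active, but it
stretches volume by \<open>sqrt (1 + t\<^sup>2) > 1\<close>.\<close>

lemma v_nonzero: "v i \<noteq> 0"
proof
  assume v0: "v i = 0"
  define q :: "real ^ 'n" where "q = axis i 1"
  have qx: "x $ i = 0" "q \<bullet> x = 0" if "x \<in> H" for x
    using component_eq[OF that, of i] v0 by (simp_all add: q_def inner_axis')
  have "\<not> H \<subseteq> {0}" using dim_pos dim_H dim_eq_0[of H] by simp
  then obtain x where x: "x \<in> H" "x \<noteq> 0" by auto
  define w where "w = x /\<^sub>R norm x"
  have w: "w \<in> H" "norm w = 1" using x subspace_H by (auto simp: w_def subspace_scale)
  let ?H0 = "{x \<in> H. x \<bullet> w = 0}"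
  have "orth_proj ?H0 q = 0"
    using qx by (intro orth_proj_eqI[OF subspace_orthogonal_section[OF subspace_H]])
      (auto simp: subspace_0[OF subspace_H])
  then have z: "tilt_normal H w q t = w + t *\<^sub>R q" for t by (simp add: tilt_normal_def)
  have nz: "(norm (tilt_normal H w q t))\<^sup>2 = 1 + t\<^sup>2" for t
  proof -
    have "orthogonal w (t *\<^sub>R q)" using qx(2)[OF w(1)] by (simp add: orthogonal_def inner_commute)
    from norm_add_Pythagorean[OF this] show ?thesis
      unfolding z using w(2) by (simp add: q_def norm_axis_1)
  qed
  obtain R where R: "R > 0" "\<And>x. x \<in> cube_section H \<Longrightarrow> norm x \<le> R"
    using bounded_cube_section[of H] unfolding bounded_pos by blast
  \<comment> \<open>below \<open>1 / R\<close> the perturbed constraint holds on the whole section\<close>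
  have "\<forall>\<^sub>F t in at 0. \<bar>t\<bar> < 1 / R"
    using R(1) by (auto simp: eventually_at intro!: exI[of _ "1 / R"])
  moreover have "\<forall>\<^sub>F t::real in at 0. t \<noteq> 0" by (simp add: eventually_at_filter)
  ultimately have "\<forall>\<^sub>F t::real in at 0. False"
    using local_maximizer_tilt[OF subspace_H w dim_H maximal, of q]
  proof eventually_elim
    case (elim t)
    have "{x \<in> H. \<forall>j. \<bar>tilt w q t x $ j\<bar> \<le> 1} = cube_section H"
    proof (intro equalityI subsetI)
      fix x assume x: "x \<in> {x \<in> H. \<forall>j. \<bar>tilt w q t x $ j\<bar> \<le> 1}"
      have "\<bar>x $ j\<bar> \<le> 1" for j
      proof (cases "j = i")
        case True
        then show ?thesis using x qx(1)[of x] by simp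
      next
        case False
        then have "tilt w q t x $ j = x $ j" by (simp add: tilt_def q_def axis_def)
        then show ?thesis using x by (metis (mono_tags, lifting) mem_Collect_eq)
      qed
      then show "x \<in> cube_section H" using x by (simp add: cube_section_eq)
    next
      fix x assume x: "x \<in> cube_section H"
      then have xH: "x \<in> H" by (simp add: cube_section_eq)
      have "\<bar>x \<bullet> w\<bar> \<le> R" using Cauchy_Schwarz_ineq2[of x w] R(2)[OF x] w(2) by simp
      then have "\<bar>t\<bar> * \<bar>x \<bullet> w\<bar> \<le> (1 / R) * R"
        using elim(1) R(1) by (intro mult_mono) auto
      then have "\<bar>t * (x \<bullet> w)\<bar> \<le> 1" using R(1) by (simp add: abs_mult)
      moreover have "tilt w q t x $ j = x $ j + (if j = i then t * (x \<bullet> w) else 0)" for j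
        by (simp add: tilt_def q_def axis_def)
      ultimately have "\<bar>tilt w q t x $ j\<bar> \<le> 1" for j
        using x qx(1)[OF xH] by (simp add: cube_section_eq)
      with xH show "x \<in> {x \<in> H. \<forall>j. \<bar>tilt w q t x $ j\<bar> \<le> 1}" by simp
    qed
    then have "norm (tilt_normal H w q t) * measure (subspace_lborel H) (cube_section H)
        \<le> 1 * measure (subspace_lborel H) (cube_section H)"
      using elim(3) by simp
    then have "norm (tilt_normal H w q t) \<le> 1"
      using cube_section_measure_pos[OF subspace_H] by (rule mult_right_le_imp_le)
    then have "(norm (tilt_normal H w q t))\<^sup>2 \<le> 1" by (simp add: power_le_one)
    moreover have "t\<^sup>2 > 0" using elim(2) by simp
    ultimately show False using nz[of t] by linarith
  qed
  then show False by simp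
qed

text \<open>The constraints that bound the hyperplane \<open>x \<bullet> g = 1\<close>. The condition \<open>parallel_class g \<noteq> {}\<close> expresses
that \<open>g\<close> is \<open>v i\<close> or \<open>- v i\<close> for some \<open>i\<close>, which treats opposite facets alike.\<close>

definition parallel_class :: "real ^ 'n \<Rightarrow> 'n set" where
  "parallel_class g = {j. v j = g \<or> v j = - g}"

text \<open>The foot of the perpendicular from \<open>0\<close> to the hyperplane \<open>x \<bullet> g = 1\<close>.\<close>

definition pole :: "real ^ 'n \<Rightarrow> real ^ 'n" where
  "pole g = g /\<^sub>R (g \<bullet> g)"

text \<open>The class is moved as a whole, with signs chosen such that all its constraints remain a single slab
\<open>\<bar>x \<bullet> g + t (x \<bullet> w)\<bar> \<le> 1\<close>; the remaining constraints, indexed by \<open>J\<close>, stay fixed. The class has to be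
nonempty: otherwise the slab would not be among the constraints that define the section.\<close>

lemma first_order_condition_unit:
  assumes g: "g \<in> H" "g \<noteq> 0" "parallel_class g \<noteq> {}" and w: "w \<in> H" "norm w = 1"
  shows "real (card (parallel_class g)) * (g \<bullet> w) * measure (subspace_lborel H) (cube_section H)
       = 2 / norm g * (LINT y|subspace_lborel {x \<in> H. x \<bullet> g = 0}.
           indicator (cube_section H) (pole g + y) * ((pole g + y) \<bullet> w))"
proof -
  define J where "J = - parallel_class g"
  define q :: "real ^ 'n" where "q = (\<chi> j. if v j = g then 1 else if v j = - g then - 1 else 0)"
  define M where "M t = measure (subspace_lborel H)
      {x \<in> H. (\<forall>j\<in>J. \<bar>x \<bullet> v j\<bar> \<le> 1) \<and> \<bar>x \<bullet> g + t * (x \<bullet> w)\<bar> \<le> 1}" for t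
  define I where "I = (LINT y|subspace_lborel {x \<in> H. x \<bullet> g = 0}.
      indicator {x. \<forall>j\<in>J. \<bar>x \<bullet> v j\<bar> \<le> 1} (pole g + y) * ((pole g + y) \<bullet> w))"
  have gne: "g \<noteq> - g"
  proof
    assume "g = - g"
    then have "g + g = 0" by (metis add.right_inverse)
    then show False using g(2) by (simp add: scaleR_2[symmetric])
  qed
  have q_comp: "q $ j = (if v j = g then 1 else if v j = - g then - 1 else 0)" for j
    by (simp add: q_def)
  have tilt_comp: "\<bar>tilt w q t x $ j\<bar> = (if j \<in> J then \<bar>x \<bullet> v j\<bar> else \<bar>x \<bullet> g + t * (x \<bullet> w)\<bar>)"
    if x: "x \<in> H" for t x j
  proof -
    have "tilt w q t x $ j = x \<bullet> v j + t * (x \<bullet> w) * q $ j"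
      using component_eq[OF x, of j] by (simp add: tilt_def)
    moreover have "\<bar>- (x \<bullet> g) - t * (x \<bullet> w)\<bar> = \<bar>x \<bullet> g + t * (x \<bullet> w)\<bar>" by linarith
    ultimately show ?thesis
      using gne by (auto simp: q_comp J_def parallel_class_def)
  qed
  obtain j0 where j0: "j0 \<notin> J" using g(3) by (auto simp: J_def)
  have tilted: "(\<forall>j. \<bar>tilt w q t x $ j\<bar> \<le> 1) \<longleftrightarrow>
      (\<forall>j\<in>J. \<bar>x \<bullet> v j\<bar> \<le> 1) \<and> \<bar>x \<bullet> g + t * (x \<bullet> w)\<bar> \<le> 1" if x: "x \<in> H" for t x
    unfolding tilt_comp[OF x] using j0 by auto
  have M_tilt: "M t = measure (subspace_lborel H) {x \<in> H. \<forall>j. \<bar>tilt w q t x $ j\<bar> \<le> 1}" for t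
    unfolding M_def
    by (rule arg_cong[of _ _ "measure (subspace_lborel H)"], rule Collect_cong, rule conj_cong[OF refl])
       (rule tilted[symmetric])
  have M0: "M 0 = measure (subspace_lborel H) (cube_section H)"
    unfolding M_tilt by (rule arg_cong[of _ _ "measure (subspace_lborel H)"])
      (auto simp: cube_section_eq tilt_def)

  obtain R1 where R1: "\<And>x :: real ^ 'n. (\<forall>j. \<bar>x $ j\<bar> \<le> 1) \<Longrightarrow> norm x \<le> R1"
    using bounded_unit_cube[where 'n = 'n] unfolding bounded_iff by blast
  \<comment> \<open>small enough for the tilt not to shrink any vector by more than a factor 2\<close>
  define \<delta> where "\<delta> = 1 / (2 * (norm q + 1))"
  have nq: "norm q \<ge> 0" by simp
  have \<delta>: "\<delta> > 0" "\<delta> * norm q \<le> 1 / 2"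
    using nq by (auto simp: \<delta>_def divide_simps add_nonneg_pos)
  have bd: "norm x \<le> 2 * R1"
    if t: "\<bar>t\<bar> \<le> \<delta>" and x: "x \<in> H" and s: "\<forall>j\<in>J. \<bar>x \<bullet> v j\<bar> \<le> 1" "\<bar>x \<bullet> g + t * (x \<bullet> w)\<bar> \<le> 1" for t x
  proof -
    have "norm (tilt w q t x) \<le> R1" using tilted[OF x, of t] s by (intro R1) simp
    moreover have "norm x \<le> norm (tilt w q t x) + norm ((t * (x \<bullet> w)) *\<^sub>R q)"
      using norm_triangle_ineq4[of "tilt w q t x" "(t * (x \<bullet> w)) *\<^sub>R q"] by (simp add: tilt_def)
    moreover have "norm ((t * (x \<bullet> w)) *\<^sub>R q) \<le> 1 / 2 * norm x"
    proof -
      have "\<bar>x \<bullet> w\<bar> \<le> norm x" using Cauchy_Schwarz_ineq2[of x w] w by simp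
      then have "(\<bar>t\<bar> * norm q) * \<bar>x \<bullet> w\<bar> \<le> (\<delta> * norm q) * norm x"
        using t \<delta> by (intro mult_mono) auto
      also have "\<dots> \<le> 1 / 2 * norm x" using \<delta>(2) by (intro mult_right_mono) auto
      finally show ?thesis by (simp add: abs_mult mult_ac)
    qed
    ultimately show ?thesis by linarith
  qed
  have deriv: "(M has_real_derivative - (2 / norm g * I)) (at 0)"
    unfolding M_def[abs_def] I_def pole_def
    using bd by (intro slab_volume_derivative[OF subspace_H g(1,2) _ _ _ _ \<delta>(1), where R = "2 * R1"])
      (auto simp: J_def parallel_class_def v_mem)

  have qw: "q \<bullet> w = real (card (parallel_class g)) * (g \<bullet> w)"
  proof -
    have "q $ j * w $ j = (if j \<in> parallel_class g then g \<bullet> w else 0)" for j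
      using component_eq[OF w(1), of j] gne
      by (auto simp: q_comp parallel_class_def inner_commute)
    then have "q \<bullet> w = (\<Sum>j\<in>UNIV. if j \<in> parallel_class g then g \<bullet> w else 0)"
      by (simp add: inner_vec_def)
    then show ?thesis by (simp add: sum.If_cases)
  qed
  have "\<forall>\<^sub>F t in at 0. (1 + t * (q \<bullet> w)) * M t \<le> M 0"
    using local_maximizer_tilt[OF subspace_H w dim_H maximal, of q]
  proof eventually_elim
    case (elim t)
    have "(1 + t * (q \<bullet> w)) * M t \<le> norm (tilt_normal H w q t) * M t"
      by (intro mult_right_mono norm_tilt_normal_ge[OF subspace_H w]) (simp add: M_def)
    with elim show ?case by (simp add: M_tilt M0[unfolded M_tilt])
  qed
  then obtain d where d: "d > 0" "\<And>t. t \<noteq> 0 \<Longrightarrow> \<bar>t\<bar> < d \<Longrightarrow> (1 + t * (q \<bullet> w)) * M t \<le> M 0"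
    unfolding eventually_at by (auto simp: dist_real_def)
  have "((\<lambda>t. (1 + t * (q \<bullet> w)) * M t) has_real_derivative
      ((q \<bullet> w) * M 0 + - (2 / norm g * I) * (1 + 0 * (q \<bullet> w)))) (at 0)"
    by (rule DERIV_mult[OF _ deriv]) (auto intro!: derivative_eq_intros)
  \<comment> \<open>\<open>(1 + t (q \<bullet> w)) M t\<close> has a local maximum at \<open>t = 0\<close>\<close>
  then have "(q \<bullet> w) * M 0 + - (2 / norm g * I) * (1 + 0 * (q \<bullet> w)) = 0"
  proof (rule DERIV_local_max[OF _ d(1)], intro allI impI)
    fix t assume "\<bar>0 - t\<bar> < d"
    then show "(1 + t * (q \<bullet> w)) * M t \<le> (1 + 0 * (q \<bullet> w)) * M 0"
      using d(2)[of t] by (cases "t = 0") auto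
  qed
  then have main: "(q \<bullet> w) * M 0 = 2 / norm g * I" by simp

  let ?W = "{x \<in> H. x \<bullet> g = 0}"
  have W: "subspace ?W" by (rule subspace_orthogonal_section[OF subspace_H])
  have pole: "pole g \<in> H" "pole g \<bullet> g = 1"
    using g subspace_H by (auto simp: pole_def subspace_scale)
  have [measurable]: "cube_section H \<in> sets borel"
    by (rule borel_closed[OF closed_cube_section[OF subspace_H]])
  have [measurable]: "{x. \<forall>j\<in>J. \<bar>x \<bullet> v j\<bar> \<le> 1} \<in> sets borel"
  proof -
    have "{x. \<forall>j\<in>J. \<bar>x \<bullet> v j\<bar> \<le> 1} = (\<Inter>j\<in>J. {x. \<bar>x \<bullet> v j\<bar> \<le> 1})" by auto
    moreover have "closed {x. \<bar>x \<bullet> v j\<bar> \<le> 1}" for j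
      by (intro closed_Collect_le continuous_intros)
    ultimately show ?thesis by (intro borel_closed) (simp only:, intro closed_INT ballI)
  qed
  have "I = (LINT y|subspace_lborel ?W. indicator (cube_section H) (pole g + y) * ((pole g + y) \<bullet> w))"
    unfolding I_def
  proof (rule integral_cong_AE)
    show "AE y in subspace_lborel ?W.
        indicator {x. \<forall>j\<in>J. \<bar>x \<bullet> v j\<bar> \<le> 1} (pole g + y) * ((pole g + y) \<bullet> w)
        = indicator (cube_section H) (pole g + y) * ((pole g + y) \<bullet> w)"
      using AE_subspace_lborel[OF W]
    proof eventually_elim
      case (elim y)
      have mem: "pole g + y \<in> H" using elim pole subspace_H by (auto intro: subspace_add)
      have one: "(pole g + y) \<bullet> g = 1" using elim pole by (simp add: inner_left_distrib)
      have "\<bar>(pole g + y) \<bullet> v j\<bar> \<le> 1" if "j \<notin> J" for j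
      proof -
        have "v j = g \<or> v j = - g" using that by (simp add: J_def parallel_class_def)
        then show ?thesis
        proof
          assume "v j = - g"
          then have "(pole g + y) \<bullet> v j = - ((pole g + y) \<bullet> g)" by (simp only: inner_minus_right)
          then show ?thesis using one by simp
        qed (use one in simp)
      qed
      then have "pole g + y \<in> cube_section H \<longleftrightarrow> (\<forall>j\<in>J. \<bar>(pole g + y) \<bullet> v j\<bar> \<le> 1)"
        using mem by (auto simp: section_eq)
      then show ?case by (simp add: indicator_def)
    qed
  qed measurable
  with main show ?thesis by (simp add: qw M0)
qed

text \<open>Both sides are linear in \<open>u\<close> and only see its projection to \<open>H\<close>.\<close>

lemma first_order_condition:
  assumes g: "g \<in> H" "g \<noteq> 0" "parallel_class g \<noteq> {}"
  shows "real (card (parallel_class g)) * (g \<bullet> u) * measure (subspace_lborel H) (cube_section H)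
       = 2 / norm g * (LINT y|subspace_lborel {x \<in> H. x \<bullet> g = 0}.
           indicator (cube_section H) (pole g + y) * ((pole g + y) \<bullet> u))"
proof -
  define p where "p = orth_proj H u"
  have p: "p \<in> H" unfolding p_def by (rule orth_proj_mem[OF subspace_H])
  have pu: "x \<bullet> u = x \<bullet> p" if "x \<in> H" for x
    unfolding p_def using orth_proj_inner[OF subspace_H that] by simp
  have ind: "indicator (cube_section H) (pole g + y) * ((pole g + y) \<bullet> u)
      = indicator (cube_section H) (pole g + y) * ((pole g + y) \<bullet> p)" for y
    by (cases "pole g + y \<in> cube_section H") (auto simp: cube_section_eq intro: pu)
  show ?thesis
  proof (cases "p = 0")
    case True
    then show ?thesis unfolding ind pu[OF g(1)] by simp
  next
    case False
    define w where "w = p /\<^sub>R norm p"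
    have w: "w \<in> H" "norm w = 1" "p = norm p *\<^sub>R w"
      using False p subspace_H by (auto simp: w_def subspace_scale)
    have scale: "x \<bullet> p = norm p * (x \<bullet> w)" for x by (subst w(3)) simp
    have "indicator (cube_section H) (pole g + y) * ((pole g + y) \<bullet> p)
        = norm p * (indicator (cube_section H) (pole g + y) * ((pole g + y) \<bullet> w))" for y
      unfolding scale by simp
    then have "(LINT y|subspace_lborel {x \<in> H. x \<bullet> g = 0}.
          indicator (cube_section H) (pole g + y) * ((pole g + y) \<bullet> p))
        = norm p * (LINT y|subspace_lborel {x \<in> H. x \<bullet> g = 0}.
          indicator (cube_section H) (pole g + y) * ((pole g + y) \<bullet> w))"
      by (simp only: integral_mult_right_zero)
    with arg_cong[OF first_order_condition_unit[OF g w(1,2)], of "(*) (norm p)"]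
    show ?thesis
      unfolding ind pu[OF g(1)] scale[of g] by (simp only: mult_ac)
  qed
qed

section \<open>The faces cut out by the normals\<close>

lemma normal_mem: "parallel_class g \<noteq> {} \<Longrightarrow> g \<in> H"
  using v_mem subspace_neg[OF subspace_H] by (fastforce simp: parallel_class_def)

lemma normal_nonzero: "parallel_class g \<noteq> {} \<Longrightarrow> g \<noteq> 0"
  using v_nonzero by (auto simp: parallel_class_def)

lemma normal_bound: "parallel_class g \<noteq> {} \<Longrightarrow> x \<in> cube_section H \<Longrightarrow> \<bar>x \<bullet> g\<bar> \<le> 1"
proof -
  assume "parallel_class g \<noteq> {}" and x: "x \<in> cube_section H"
  then obtain j where "v j = g \<or> v j = - g" by (auto simp: parallel_class_def)
  moreover have "\<bar>x \<bullet> v j\<bar> \<le> 1" using x by (simp add: section_eq)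
  ultimately show "\<bar>x \<bullet> g\<bar> \<le> 1" by (metis abs_minus_cancel inner_minus_right)
qed

definition slice_direction :: "real ^ 'n \<Rightarrow> (real ^ 'n) set" where
  "slice_direction g = {x \<in> H. x \<bullet> g = 0}"

definition face :: "real ^ 'n \<Rightarrow> (real ^ 'n) set" where
  "face g = cube_section H \<inter> {x \<in> H. x \<bullet> g = 1}"

text \<open>The area of \<open>face g\<close>, measured in the linear hyperplane parallel to it. Unlike \<open>vol (k - 1)\<close>, it is
meaningful before \<open>face g\<close> is known to have dimension \<open>k - 1\<close>; afterwards the two agree
(\<open>vol_face\<close>).\<close>

definition face_area :: "real ^ 'n \<Rightarrow> real" where
  "face_area g = measure (subspace_lborel (slice_direction g)) {y. pole g + y \<in> cube_section H}"

lemma subspace_slice_direction: "subspace (slice_direction g)"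
  unfolding slice_direction_def by (rule subspace_orthogonal_section[OF subspace_H])

lemma cube_section_borel [measurable]: "cube_section H \<in> sets borel"
  by (rule borel_closed[OF closed_cube_section[OF subspace_H]])

lemma bounded_slice: "bounded {y. pole g + y \<in> cube_section H}"
proof -
  have "{y. pole g + y \<in> cube_section H} = (\<lambda>x. x - pole g) ` cube_section H"
    by (force simp: image_iff)
  then show ?thesis using bounded_translation_minus[OF bounded_cube_section] by simp
qed

lemma convex_cube_section: "convex (cube_section H)"
proof -
  have "cube_section H = H \<inter> (\<Inter>j. {x. - 1 \<le> v j \<bullet> x} \<inter> {x. v j \<bullet> x \<le> 1})"
    by (auto simp: section_eq abs_le_iff inner_commute)
  moreover have "convex \<dots>"
    by (intro convex_Int convex_INT convex_halfspace_le convex_halfspace_ge subspace_imp_convex subspace_H)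
  ultimately show ?thesis by simp
qed

context
  fixes g
  assumes normal: "parallel_class g \<noteq> {}"
begin

lemma pole_mem: "pole g \<in> H"
  using normal_mem[OF normal] subspace_H by (simp add: pole_def subspace_scale)

lemma pole_inner_self: "pole g \<bullet> g = 1"
  using normal_nonzero[OF normal] by (simp add: pole_def)

lemma slice_point:
  assumes "y \<in> slice_direction g"
  shows "pole g + y \<in> H" "(pole g + y) \<bullet> g = 1" "pole g + y \<in> face g \<longleftrightarrow> pole g + y \<in> cube_section H"
proof -
  show *: "pole g + y \<in> H" "(pole g + y) \<bullet> g = 1"
    using assms pole_mem pole_inner_self subspace_H
    by (auto simp: slice_direction_def inner_left_distrib intro: subspace_add)
  show "pole g + y \<in> face g \<longleftrightarrow> pole g + y \<in> cube_section H" using * by (simp add: face_def)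
qed

lemma face_area_eq_integral:
  "(LINT y|subspace_lborel (slice_direction g). indicator (cube_section H) (pole g + y)) = face_area g"
proof -
  have "(LINT y|subspace_lborel (slice_direction g). indicator (cube_section H) (pole g + y))
      = (LINT y|subspace_lborel (slice_direction g). indicator {y. pole g + y \<in> cube_section H} y :: real)"
    by (intro Bochner_Integration.integral_cong) (auto simp: indicator_def)
  also have "\<dots> = measure (subspace_lborel (slice_direction g)) {y. pole g + y \<in> cube_section H}"
  proof -
    have [measurable]: "{y. pole g + y \<in> cube_section H} \<in> sets borel" by measurable
    show ?thesis by (simp add: Int_def)
  qed
  finally show ?thesis by (simp add: face_area_def)
qed

lemma area_balance:
  "real (card (parallel_class g)) * (g \<bullet> g) * measure (subspace_lborel H) (cube_section H)
     = 2 / norm g * face_area g"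
proof -
  have "(LINT y|subspace_lborel {x \<in> H. x \<bullet> g = 0}.
        indicator (cube_section H) (pole g + y) * ((pole g + y) \<bullet> g))
      = (LINT y|subspace_lborel (slice_direction g). indicator (cube_section H) (pole g + y))"
    unfolding slice_direction_def[symmetric]
  proof (rule integral_cong_AE)
    show "AE y in subspace_lborel (slice_direction g).
        indicator (cube_section H) (pole g + y) * ((pole g + y) \<bullet> g)
        = (indicator (cube_section H) (pole g + y) :: real)"
      using AE_subspace_lborel[OF subspace_slice_direction]
      by eventually_elim (simp add: slice_point)
  qed measurable
  with first_order_condition[OF normal_mem[OF normal] normal_nonzero[OF normal] normal, of g]
  show ?thesis by (simp add: face_area_eq_integral)
qed

lemma card_parallel_class_pos: "card (parallel_class g) > 0"
  using normal by (simp add: card_gt_0_iff)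

lemma face_area_pos: "face_area g > 0"
proof -
  have "0 < real (card (parallel_class g)) * (g \<bullet> g) * measure (subspace_lborel H) (cube_section H)"
    using card_parallel_class_pos normal_nonzero[OF normal] cube_section_measure_pos[OF subspace_H]
    by (intro mult_pos_pos) auto
  then have "0 < 2 / norm g * face_area g" by (simp only: area_balance)
  then show ?thesis using normal_nonzero[OF normal] by (simp add: zero_less_mult_iff zero_less_divide_iff)
qed

text \<open>Dividing the first-order condition for \<open>u\<close> by the one for \<open>g\<close> eliminates the volume and the size of
the class; what remains says that the first moment of the face is its area times the pole.\<close>

lemma moment_balance:
  "(LINT y|subspace_lborel (slice_direction g).
      indicator (cube_section H) (pole g + y) * ((pole g + y) \<bullet> u)) = face_area g * (pole g \<bullet> u)"
    (is "?I = _")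
proof -
  have g0: "norm g > 0" "g \<bullet> g > 0" using normal_nonzero[OF normal] by auto
  have "real (card (parallel_class g)) * (g \<bullet> u) * measure (subspace_lborel H) (cube_section H)
      = 2 / norm g * ?I"
    unfolding slice_direction_def
    by (rule first_order_condition[OF normal_mem[OF normal] normal_nonzero[OF normal] normal])
  then have "2 / norm g * ?I * (g \<bullet> g)
      = (real (card (parallel_class g)) * (g \<bullet> g) * measure (subspace_lborel H) (cube_section H)) * (g \<bullet> u)"
    by (simp only: mult_ac)
  also have "\<dots> = 2 / norm g * face_area g * (g \<bullet> u)" by (simp only: area_balance)
  finally have eq: "2 / norm g * (?I * (g \<bullet> g)) = 2 / norm g * (face_area g * (g \<bullet> u))"
    by (simp only: mult.assoc)
  have "2 / norm g \<noteq> 0" using g0 by simp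
  then have "?I * (g \<bullet> g) = face_area g * (g \<bullet> u)"
    using eq by (rule mult_left_cancel[THEN iffD1])
  then have "?I = face_area g * (g \<bullet> u) / (g \<bullet> g)"
    using g0(2) by (intro eq_divide_imp) auto
  then show ?thesis by (simp add: pole_def divide_inverse mult_ac)
qed

text \<open>By \<open>moment_balance\<close>, \<open>pole g \<bullet> u\<close> is the average of \<open>x \<bullet> u\<close> over the face, hence at most \<open>1\<close> whenever
\<open>\<bar>x \<bullet> u\<bar> \<le> 1\<close> on the section.\<close>

lemma pole_bound: "\<bar>pole g \<bullet> v j\<bar> \<le> 1"
proof -
  let ?W = "subspace_lborel (slice_direction g)"
  have le: "pole g \<bullet> u \<le> 1" if u: "\<And>x. x \<in> cube_section H \<Longrightarrow> \<bar>x \<bullet> u\<bar> \<le> 1" for u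
  proof -
    have [measurable]: "{y. pole g + y \<in> cube_section H} \<in> sets borel" by measurable
    have int: "integrable ?W (\<lambda>y. indicator (cube_section H) (pole g + y) :: real)"
    proof -
      have "integrable ?W (\<lambda>y. indicator {y. pole g + y \<in> cube_section H} y :: real)"
        using emeasure_subspace_bounded_finite[OF subspace_slice_direction bounded_slice]
        by (intro integrable_real_indicator) auto
      then show ?thesis by (simp add: indicator_def)
    qed
    have "face_area g * (pole g \<bullet> u)
        = (LINT y|?W. indicator (cube_section H) (pole g + y) * ((pole g + y) \<bullet> u))"
      by (rule moment_balance[symmetric])
    also have "\<dots> \<le> (LINT y|?W. indicator (cube_section H) (pole g + y))"
    proof (rule integral_mono[OF _ int])
      show "integrable ?W (\<lambda>y. indicator (cube_section H) (pole g + y) * ((pole g + y) \<bullet> u))"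
        by (rule Bochner_Integration.integrable_bound[OF int])
           (auto simp: indicator_def u abs_mult)
      show "indicator (cube_section H) (pole g + y) * ((pole g + y) \<bullet> u)
          \<le> (indicator (cube_section H) (pole g + y) :: real)" for y
        using u[of "pole g + y"] by (simp add: indicator_def abs_le_iff)
    qed
    also have "\<dots> = face_area g * 1" by (simp add: face_area_eq_integral)
    finally show ?thesis using face_area_pos by simp
  qed
  have "\<bar>x \<bullet> v j\<bar> \<le> 1" "\<bar>x \<bullet> - v j\<bar> \<le> 1" if "x \<in> cube_section H" for x
    using that by (simp_all add: section_eq)
  from le[OF this(1)] le[OF this(2)] show ?thesis by (simp add: abs_le_iff)
qed

lemma pole_mem_section: "pole g \<in> cube_section H"
  using pole_mem pole_bound by (simp add: section_eq)

lemma pole_mem_face: "pole g \<in> face g"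
  using pole_mem_section pole_mem pole_inner_self by (simp add: face_def)

lemma face_of_section: "face g face_of cube_section H"
proof -
  have "cube_section H \<inter> {x. g \<bullet> x = 1} face_of cube_section H"
  proof (rule face_of_Int_supporting_hyperplane_le[OF convex_cube_section])
    fix x assume "x \<in> cube_section H"
    from normal_bound[OF normal this] show "g \<bullet> x \<le> 1" by (simp add: inner_commute abs_le_iff)
  qed
  moreover have "cube_section H \<inter> {x. g \<bullet> x = 1} = face g"
    by (auto simp: face_def inner_commute cube_section_eq)
  ultimately show ?thesis by simp
qed

lemma face_subset_slice: "face g \<subseteq> (+) (pole g) ` slice_direction g"
proof
  fix x assume x: "x \<in> face g"
  then have "x - pole g \<in> slice_direction g"
    using pole_mem pole_inner_self subspace_H
    by (auto simp: face_def slice_direction_def inner_diff_left intro: subspace_diff)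
  then have "pole g + (x - pole g) \<in> (+) (pole g) ` slice_direction g" by blast
  then show "x \<in> (+) (pole g) ` slice_direction g" by simp
qed

text \<open>If the directions of the face did not span the slice, the face would lie in a proper hyperplane of it
and have area \<open>0\<close>, contrary to \<open>face_area_pos\<close>.\<close>

lemma affine_hull_face: "affine hull (face g) = (+) (pole g) ` slice_direction g"
proof -
  let ?W = "slice_direction g"
  define D where "D = span ((\<lambda>x. - pole g + x) ` face g)"
  have hull: "affine hull (face g) = (+) (pole g) ` D"
    unfolding D_def by (rule affine_hull_span_gen[OF hull_inc[OF pole_mem_face]])
  have DW: "D \<subseteq> ?W"
    unfolding D_def
    by (rule span_minimal[OF _ subspace_slice_direction]) (use face_subset_slice in force)
  have "D = ?W"
  proof (rule ccontr)
    assume "D \<noteq> ?W"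
    then have "span D \<subset> span ?W"
      using DW by (simp add: D_def span_span subspace_slice_direction span_eq_iff[THEN iffD2] psubset_eq)
    then obtain a where a: "a \<noteq> 0" "a \<in> span ?W" "\<And>y. y \<in> span D \<Longrightarrow> orthogonal a y"
      using orthogonal_to_subspace_exists_gen[of D ?W] by metis
    have aW: "a \<in> ?W" using a(2) subspace_slice_direction by (simp add: span_eq_iff[THEN iffD2])
    have "AE y in subspace_lborel ?W. y \<in> {y. pole g + y \<in> cube_section H} \<longrightarrow> y \<in> {y. y \<bullet> a = 0}"
      using AE_subspace_lborel[OF subspace_slice_direction]
    proof eventually_elim
      case (elim y)
      show ?case
      proof
        assume "y \<in> {y. pole g + y \<in> cube_section H}"
        then have "pole g + y \<in> face g" using slice_point(3)[OF elim] by simp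
        then have "- pole g + (pole g + y) \<in> (\<lambda>x. - pole g + x) ` face g" by blast
        then have "y \<in> span D" by (simp add: D_def span_base span_span)
        from a(3)[OF this] show "y \<in> {y. y \<bullet> a = 0}" by (simp add: orthogonal_def inner_commute)
      qed
    qed
    then have "emeasure (subspace_lborel ?W) {y. pole g + y \<in> cube_section H}
        \<le> emeasure (subspace_lborel ?W) {y. y \<bullet> a = 0}"
      by (rule emeasure_mono_AE) measurable
    also have "\<dots> = 0"
      by (rule emeasure_subspace_hyperplane[OF subspace_slice_direction aW a(1)])
    finally have "face_area g = 0" by (simp add: face_area_def measure_def)
    with face_area_pos show False by simp
  qed
  with hull show ?thesis by simp
qed

lemma dim_slice_direction: "dim (slice_direction g) + 1 = k"
  unfolding slice_direction_def dim_H[symmetric]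
  by (rule dim_orthogonal_section[OF subspace_H normal_mem[OF normal] normal_nonzero[OF normal]])

lemma aff_dim_face: "aff_dim (face g) = int (k - 1)"
proof -
  have "aff_dim (face g) = aff_dim ((+) (pole g) ` slice_direction g)"
    unfolding affine_hull_face[symmetric] by (rule aff_dim_affine_hull[symmetric])
  also have "\<dots> = int (dim (slice_direction g))"
    by (simp add: aff_dim_translation_eq aff_dim_subspace subspace_slice_direction)
  also have "dim (slice_direction g) = k - 1" using dim_slice_direction by simp
  finally show ?thesis .
qed

lemma aff_dim_section: "aff_dim (cube_section H) = int k"
  using aff_dim_cube_section[of H k] subspace_H dim_H by (simp add: grassmannian_def)

lemma face_facet: "face g facet_of cube_section H"
  using face_of_section pole_mem_face aff_dim_face aff_dim_section dim_pos
  by (auto simp: facet_of_def)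

lemma face_borel [measurable]: "face g \<in> sets borel"
proof -
  have "face g = cube_section H \<inter> {x. x \<bullet> g = 1}" by (auto simp: face_def cube_section_eq)
  then show ?thesis by simp
qed

lemma vol_face: "vol (k - 1) (face g) = face_area g"
proof -
  have "vol (k - 1) (face g)
      = measure (subspace_lborel (slice_direction g)) {y. pole g + y \<in> face g}"
    by (rule vol_eq_subspace_measure[OF subspace_slice_direction affine_hull_face aff_dim_face face_borel])
  also have "\<dots> = face_area g"
    unfolding face_area_def
    by (rule measure_eq_AE)
       (use AE_subspace_lborel[OF subspace_slice_direction] in eventually_elim, auto simp: slice_point)
  finally show ?thesis .
qed

lemma centroid_face: "centroid (k - 1) (face g) = pole g"
proof -
  let ?W = "subspace_lborel (slice_direction g)"
  define f where "f y = indicator (face g) (pole g + y) *\<^sub>R (pole g + y)" for y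
  have [measurable]: "f \<in> borel_measurable borel"
    unfolding f_def by measurable
  have "(LINT x:face g|affine_lborel (affine hull (face g)). x) = (LINT y|?W. f y)"
    unfolding set_lebesgue_integral_def affine_hull_face affine_lborel_translate[OF subspace_slice_direction] f_def
    by (subst integral_distr) auto
  moreover have "integrable ?W f"
  proof -
    obtain R where R: "R > 0" "\<And>x. x \<in> cube_section H \<Longrightarrow> norm x \<le> R"
      using bounded_cube_section[of H] unfolding bounded_pos by blast
    have [measurable]: "{y. pole g + y \<in> cube_section H} \<in> sets borel" by measurable
    have "integrable ?W (\<lambda>y. indicator {y. pole g + y \<in> cube_section H} y * R :: real)"
      using emeasure_subspace_bounded_finite[OF subspace_slice_direction bounded_slice]
      by (intro integrable_mult_left integrable_real_indicator) auto
    then show ?thesis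
    proof (rule Bochner_Integration.integrable_bound)
      show "AE y in ?W. norm (f y) \<le> norm (indicator {y. pole g + y \<in> cube_section H} y * R)"
        using R by (intro AE_I2) (auto simp: f_def indicator_def face_def)
    qed measurable
  qed
  moreover have "(LINT y|?W. f y) = face_area g *\<^sub>R pole g"
  proof (rule vector_eq_rdot[THEN iffD1], rule allI)
    fix u
    have "(LINT y|?W. f y) \<bullet> u = (LINT y|?W. f y \<bullet> u)"
      using \<open>integrable ?W f\<close> by simp
    also have "\<dots> = (LINT y|?W. indicator (cube_section H) (pole g + y) * ((pole g + y) \<bullet> u))"
    proof (rule integral_cong_AE)
      show "AE y in ?W. f y \<bullet> u = indicator (cube_section H) (pole g + y) * ((pole g + y) \<bullet> u)"
        using AE_subspace_lborel[OF subspace_slice_direction]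
        by eventually_elim (simp add: f_def indicator_def slice_point(3))
    qed measurable
    finally show "(LINT y|?W. f y) \<bullet> u = (face_area g *\<^sub>R pole g) \<bullet> u"
      by (simp add: moment_balance)
  qed
  ultimately show ?thesis
    using face_area_pos unfolding centroid_def vol_face by simp
qed

end

section \<open>Facets, boundary points on the normals and cones\<close>

lemma normal_v: "parallel_class (v i) \<noteq> {}" "parallel_class (- v i) \<noteq> {}"
  by (auto simp: parallel_class_def)

text \<open>A relatively interior point of a facet is a boundary point of the section, so some constraint is
active there. The face of that constraint then contains the whole facet, and both have the same
dimension.\<close>

lemma facet_eq_face:
  assumes F: "F facet_of cube_section H"
  obtains g where "parallel_class g \<noteq> {}" "F = face g"
proof -
  let ?P = "cube_section H"
  have Fface: "F face_of ?P" and "F \<noteq> {}" and dimF: "aff_dim F = aff_dim ?P - 1"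
    using F by (auto simp: facet_of_def)
  have "convex F" using Fface by (rule face_of_imp_convex)
  then obtain x where x: "x \<in> rel_interior F"
    using \<open>F \<noteq> {}\<close> rel_interior_eq_empty by blast
  have xF: "x \<in> F" using x rel_interior_subset by blast
  then have xP: "x \<in> ?P" using Fface face_of_imp_subset by blast
  have "F \<noteq> ?P" using dimF by auto
  then have not_int: "x \<notin> rel_interior ?P"
    using face_of_disjoint_rel_interior[OF Fface] xF by blast
  \<comment> \<open>otherwise all constraints would be strict, and x would be relatively interior to the section\<close>
  have "\<exists>j. \<bar>x \<bullet> v j\<bar> = 1"
  proof (rule ccontr)
    assume "\<not> ?thesis"
    then have lt: "\<bar>x \<bullet> v j\<bar> < 1" for j
      using xP by (simp add: section_eq less_le)
    let ?T = "\<Inter>j. {y. \<bar>y \<bullet> v j\<bar> < 1}"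
    have "open ?T" by (intro open_INT ballI open_Collect_less continuous_intros) auto
    moreover have "?T \<inter> affine hull ?P \<subseteq> ?P"
      unfolding affine_hull_cube_section[OF subspace_H]
      by (auto simp: section_eq less_imp_le)
    moreover have "x \<in> ?T \<inter> ?P" using lt xP by simp
    ultimately have "x \<in> rel_interior ?P" unfolding mem_rel_interior by blast
    with not_int show False by simp
  qed
  then obtain j where "\<bar>x \<bullet> v j\<bar> = 1" by blast
  then have "x \<bullet> v j = 1 \<or> x \<bullet> (- v j) = 1" by (simp add: abs_if split: if_splits)
  then obtain g where g: "parallel_class g \<noteq> {}" "x \<bullet> g = 1" using normal_v by blast
  have "x \<in> face g" using xP g(2) by (simp add: face_def cube_section_eq)
  then have "F \<subseteq> face g"
    using subset_of_face_of[OF face_of_section[OF g(1)] face_of_imp_subset[OF Fface]] x by blast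
  moreover have "face g \<subseteq> ?P" by (simp add: face_def)
  ultimately have sub: "F face_of face g" by (intro face_of_subset[OF Fface])
  have "F = face g"
  proof (rule ccontr)
    assume "F \<noteq> face g"
    from face_of_aff_dim_lt[OF _ sub this] face_of_imp_convex[OF face_of_section[OF g(1)]]
    have "aff_dim F < aff_dim (face g)" by simp
    then show False using dimF face_facet[OF g(1)] by (simp add: facet_of_def)
  qed
  with g(1) that show ?thesis by blast
qed

text \<open>At a point with an active constraint, moving outwards along the ray from \<open>0\<close> leaves the section.\<close>

lemma frontier_section:
  "x \<in> top_of_set H frontier_of cube_section H \<longleftrightarrow> x \<in> cube_section H \<and> (\<exists>j. \<bar>x \<bullet> v j\<bar> = 1)"
proof -
  let ?P = "cube_section H"
  have PH: "?P \<subseteq> H" by (auto simp: cube_section_eq)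
  have "closedin (top_of_set H) ?P"
    by (rule closed_subset[OF PH closed_cube_section[OF subspace_H]])
  then have cl: "top_of_set H closure_of ?P = ?P" by (rule closure_of_closedin)
  have "x \<in> top_of_set H interior_of ?P \<longleftrightarrow> (\<forall>j. \<bar>x \<bullet> v j\<bar> \<noteq> 1)" if xP: "x \<in> ?P"
  proof
    assume "x \<in> top_of_set H interior_of ?P"
    then obtain T where T: "openin (top_of_set H) T" "x \<in> T" "T \<subseteq> ?P"
      unfolding interior_of_def by blast
    then obtain e where e: "e > 0" "ball x e \<inter> H \<subseteq> T"
      unfolding openin_contains_ball by blast
    \<comment> \<open>a step along the ray through x that stays in the ball about x; adding 1 covers \<open>x = 0\<close>\<close>
    define N where "N = norm x + 1"
    define \<epsilon> where "\<epsilon> = e / (2 * N)"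
    have nx: "N > 0" by (simp add: N_def add_nonneg_pos)
    have \<epsilon>: "\<epsilon> > 0" using e nx by (simp add: \<epsilon>_def)
    have "\<epsilon> * norm x \<le> \<epsilon> * N" using \<epsilon> by (intro mult_left_mono) (auto simp: N_def)
    also have "\<dots> = e / 2" using nx by (simp add: \<epsilon>_def)
    also have "\<dots> < e" using e by simp
    finally have "norm (\<epsilon> *\<^sub>R x) < e" using \<epsilon> by simp
    moreover have "x + \<epsilon> *\<^sub>R x \<in> H"
      using xP PH subspace_H by (auto intro!: subspace_add subspace_scale)
    moreover have "dist x (x + \<epsilon> *\<^sub>R x) = norm (\<epsilon> *\<^sub>R x)" by (simp add: dist_norm)
    ultimately have "x + \<epsilon> *\<^sub>R x \<in> ball x e \<inter> H" by simp
    with e(2) T(3) have mem: "x + \<epsilon> *\<^sub>R x \<in> ?P" by blast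
    show "\<forall>j. \<bar>x \<bullet> v j\<bar> \<noteq> 1"
    proof (intro allI notI)
      fix j assume one: "\<bar>x \<bullet> v j\<bar> = 1"
      have "(x + \<epsilon> *\<^sub>R x) \<bullet> v j = (1 + \<epsilon>) * (x \<bullet> v j)" by (simp add: inner_left_distrib algebra_simps)
      then have "\<bar>(x + \<epsilon> *\<^sub>R x) \<bullet> v j\<bar> = 1 + \<epsilon>" using one \<epsilon> by (simp add: abs_mult)
      moreover have "\<bar>(x + \<epsilon> *\<^sub>R x) \<bullet> v j\<bar> \<le> 1" using mem unfolding section_eq by blast
      ultimately show False using \<epsilon> by linarith
    qed
  next
    assume ne: "\<forall>j. \<bar>x \<bullet> v j\<bar> \<noteq> 1"
    let ?T = "\<Inter>j. {y. \<bar>y \<bullet> v j\<bar> < 1}"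
    have "open ?T" by (intro open_INT ballI open_Collect_less continuous_intros) auto
    then have "openin (top_of_set H) (H \<inter> ?T)" by (rule openin_open_Int)
    moreover have "x \<in> H \<inter> ?T" using ne xP by (auto simp: section_eq less_le)
    moreover have "H \<inter> ?T \<subseteq> ?P" by (auto simp: section_eq less_imp_le)
    ultimately show "x \<in> top_of_set H interior_of ?P" unfolding interior_of_def by blast
  qed
  then show ?thesis unfolding frontier_of_def cl by blast
qed

text \<open>A point \<open>r \<cdot> pole (v i)\<close> of the section has \<open>\<bar>r\<bar> \<le> 1\<close>. By \<open>pole_bound\<close> no constraint can be active
at it unless \<open>\<bar>r\<bar> = 1\<close>.\<close>

lemma line_meets_frontier:
  "span {v i} \<inter> (top_of_set H frontier_of cube_section H) = {pole (v i), pole (- v i)}"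
proof -
  have pole_neg: "pole (- v i) = - pole (v i)" by (simp add: pole_def)
  have one: "pole (v i) \<bullet> v i = 1" by (rule pole_inner_self[OF normal_v(1)])
  show ?thesis
  proof (intro equalityI subsetI)
    fix x assume x: "x \<in> span {v i} \<inter> (top_of_set H frontier_of cube_section H)"
    then have "x \<in> top_of_set H frontier_of cube_section H" by blast
    then obtain j where xP: "x \<in> cube_section H" and j: "\<bar>x \<bullet> v j\<bar> = 1"
      using frontier_section by blast
    obtain \<alpha> where "x = \<alpha> *\<^sub>R v i" using x by (auto simp: span_singleton)
    then have xr: "x = (x \<bullet> v i) *\<^sub>R pole (v i)"
      using v_nonzero[of i] by (simp add: pole_def)
    have "\<bar>x \<bullet> v i\<bar> \<le> 1" using xP by (simp add: section_eq)
    moreover have "1 \<le> \<bar>x \<bullet> v i\<bar>"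
    proof -
      have "1 = \<bar>x \<bullet> v i\<bar> * \<bar>pole (v i) \<bullet> v j\<bar>"
        using j by (subst (asm) xr) (simp add: abs_mult)
      also have "\<dots> \<le> \<bar>x \<bullet> v i\<bar> * 1"
        by (intro mult_left_mono pole_bound[OF normal_v(1)]) simp
      finally show ?thesis by simp
    qed
    ultimately have "x \<bullet> v i = 1 \<or> x \<bullet> v i = - 1" by linarith
    then show "x \<in> {pole (v i), pole (- v i)}"
    proof
      assume "x \<bullet> v i = 1" then show ?thesis using xr by simp
    next
      assume "x \<bullet> v i = - 1" then show ?thesis using xr by (simp add: pole_neg)
    qed
  next
    fix x assume "x \<in> {pole (v i), pole (- v i)}"
    then have x: "x = pole (v i) \<or> x = - pole (v i)" by (auto simp: pole_neg)
    then have "x \<in> cube_section H"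
      using pole_mem_section[OF normal_v(1)[of i]] pole_mem_section[OF normal_v(2)[of i]]
      by (auto simp: pole_neg)
    moreover have "\<bar>x \<bullet> v i\<bar> = 1" using x one by auto
    moreover have "pole (v i) \<in> span {v i}"
      unfolding pole_def by (intro span_scale span_base) simp
    then have "x \<in> span {v i}" using x by (auto intro: span_neg)
    ultimately show "x \<in> span {v i} \<inter> (top_of_set H frontier_of cube_section H)"
      using frontier_section by blast
  qed
qed

text \<open>If the line of \<open>v i\<close> passes through \<open>pole g\<close>, then \<open>g = \<rho> v i\<close>. The poles of \<open>g\<close> and of \<open>v i\<close> both lie
in the section, and the constraints of \<open>v i\<close> and \<open>g\<close> at these two points give \<open>\<bar>\<rho>\<bar> \<ge> 1\<close> and
\<open>\<bar>\<rho>\<bar> \<le> 1\<close>.\<close>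

lemma pole_on_line_iff:
  assumes g: "parallel_class g \<noteq> {}"
  shows "span {v i} \<inter> face g = {centroid (k - 1) (face g)} \<longleftrightarrow> i \<in> parallel_class g"
  unfolding centroid_face[OF g]
proof
  have gg: "g \<bullet> g > 0" using normal_nonzero[OF g] by simp
  assume "span {v i} \<inter> face g = {pole g}"
  then have "pole g \<in> span {v i}" by blast
  then obtain \<alpha> where \<alpha>: "pole g = \<alpha> *\<^sub>R v i" by (auto simp: span_singleton)
  have one: "\<alpha> * (v i \<bullet> g) = 1" using pole_inner_self[OF g] by (simp add: \<alpha>)
  then have \<alpha>0: "\<alpha> \<noteq> 0" by auto
  have "\<bar>pole g \<bullet> v i\<bar> \<le> 1" by (rule pole_bound[OF g])
  then have le1: "\<bar>\<alpha>\<bar> * (v i \<bullet> v i) \<le> 1" by (simp add: \<alpha> abs_mult)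
  have "\<bar>pole (v i) \<bullet> g\<bar> \<le> 1"
    by (rule normal_bound[OF g pole_mem_section[OF normal_v(1)]])
  then have le2: "\<bar>v i \<bullet> g\<bar> \<le> v i \<bullet> v i"
    using v_nonzero[of i] by (simp add: pole_def abs_mult divide_simps split: if_splits)
  have "\<bar>\<alpha>\<bar> * \<bar>v i \<bullet> g\<bar> = 1" using one by (simp add: abs_mult[symmetric])
  moreover have "\<bar>\<alpha>\<bar> * \<bar>v i \<bullet> g\<bar> \<le> \<bar>\<alpha>\<bar> * (v i \<bullet> v i)" using le2 by (intro mult_left_mono) auto
  ultimately have eq: "\<bar>\<alpha>\<bar> * (v i \<bullet> v i) = 1" using le1 by linarith
  have "g = (g \<bullet> g) *\<^sub>R pole g" using gg by (simp add: pole_def)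
  then have g_eq: "g = ((g \<bullet> g) * \<alpha>) *\<^sub>R v i" by (simp add: \<alpha>)
  define \<rho> where "\<rho> = (g \<bullet> g) * \<alpha>"
  have \<rho>: "g = \<rho> *\<^sub>R v i" using g_eq by (simp add: \<rho>_def)
  have "\<alpha> * (\<rho> * (v i \<bullet> v i)) = 1" using one by (subst (asm) \<rho>) simp
  then have "\<bar>\<alpha> * (\<rho> * (v i \<bullet> v i))\<bar> = 1" by (simp only: abs_one)
  then have "\<bar>\<rho>\<bar> * (\<bar>\<alpha>\<bar> * (v i \<bullet> v i)) = 1" by (simp add: abs_mult mult_ac)
  then have "\<bar>\<rho>\<bar> = 1" by (simp add: eq)
  then have "\<rho> = 1 \<or> \<rho> = - 1" by linarith
  then show "i \<in> parallel_class g" using \<rho> by (auto simp: parallel_class_def)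
next
  assume "i \<in> parallel_class g"
  then have vi: "v i = g \<or> v i = - g" by (simp add: parallel_class_def)
  then have sp: "span {v i} = span {g}"
    using span_singleton[of g] span_singleton[of "- g"] by (auto simp: image_iff) (metis scaleR_minus_left minus_minus scaleR_minus_right)+
  show "span {v i} \<inter> face g = {pole g}"
  proof (intro equalityI subsetI)
    fix x assume x: "x \<in> span {v i} \<inter> face g"
    then obtain \<alpha> where \<alpha>: "x = \<alpha> *\<^sub>R g" unfolding sp by (auto simp: span_singleton)
    have "x \<bullet> g = 1" using x by (simp add: face_def)
    then have "\<alpha> * (g \<bullet> g) = 1" by (simp add: \<alpha>)
    then have "\<alpha> = inverse (g \<bullet> g)" by (metis inverse_unique mult.commute)
    then show "x \<in> {pole g}" by (simp add: \<alpha> pole_def)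
  next
    fix x assume "x \<in> {pole g}"
    moreover have "pole g \<in> span {g}"
      unfolding pole_def by (intro span_scale span_base) simp
    ultimately show "x \<in> span {v i} \<inter> face g"
      using pole_mem_face[OF g] unfolding sp by simp
  qed
qed

lemma cone_mem_iff:
  assumes g: "parallel_class g \<noteq> {}" and y: "y \<in> slice_direction g" and s: "s \<noteq> 0"
  shows "s *\<^sub>R pole g + y \<in> convex hull (insert 0 (face g))
     \<longleftrightarrow> s \<in> {0..1} \<and> pole g + (1 / s) *\<^sub>R y \<in> cube_section H"
proof -
  have cone: "convex hull (insert 0 (face g)) = {x. \<exists>t f. 0 \<le> t \<and> t \<le> 1 \<and> f \<in> face g \<and> x = t *\<^sub>R f}"
  proof -
    have "convex (face g)" by (rule face_of_imp_convex[OF face_of_section[OF g]])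
    then have "convex hull (face g) = face g" by (rule hull_same)
    then have "convex hull (insert 0 (face g))
        = {x. \<exists>u\<ge>0. \<exists>t\<ge>0. \<exists>f. u + t = 1 \<and> f \<in> face g \<and> x = u *\<^sub>R 0 + t *\<^sub>R f}"
      using pole_mem_face[OF g] by (subst convex_hull_insert) auto
    also have "\<dots> = {x. \<exists>t f. 0 \<le> t \<and> t \<le> 1 \<and> f \<in> face g \<and> x = t *\<^sub>R f}"
    proof (intro Collect_cong iffI)
      fix x assume "\<exists>t f. 0 \<le> t \<and> t \<le> 1 \<and> f \<in> face g \<and> x = t *\<^sub>R f"
      then obtain t f where "0 \<le> t" "t \<le> 1" "f \<in> face g" "x = t *\<^sub>R f" by blast
      then have "0 \<le> 1 - t" "0 \<le> t" "(1 - t) + t = 1 \<and> f \<in> face g \<and> x = (1 - t) *\<^sub>R 0 + t *\<^sub>R f" by auto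
      then show "\<exists>u\<ge>0. \<exists>t\<ge>0. \<exists>f. u + t = 1 \<and> f \<in> face g \<and> x = u *\<^sub>R 0 + t *\<^sub>R f" by blast
    qed auto
    finally show ?thesis .
  qed
  have yg: "y \<bullet> g = 0" using y by (simp add: slice_direction_def)
  have ys: "(1 / s) *\<^sub>R y \<in> slice_direction g" by (rule subspace_scale[OF subspace_slice_direction y])
  note sp = slice_point(3)[OF g ys]
  have split: "s *\<^sub>R (pole g + (1 / s) *\<^sub>R y) = s *\<^sub>R pole g + y" using s by (simp add: scaleR_right_distrib)
  show ?thesis
  proof
    assume "s *\<^sub>R pole g + y \<in> convex hull (insert 0 (face g))"
    then obtain t f where t: "0 \<le> t" "t \<le> 1" "f \<in> face g" "s *\<^sub>R pole g + y = t *\<^sub>R f"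
      unfolding cone by blast
    have "(s *\<^sub>R pole g + y) \<bullet> g = s" using yg pole_inner_self[OF g] by (simp add: inner_left_distrib)
    moreover have "(t *\<^sub>R f) \<bullet> g = t" using t(3) by (simp add: face_def)
    ultimately have "t = s" using t(4) by simp
    with t split have "s *\<^sub>R (pole g + (1 / s) *\<^sub>R y) = s *\<^sub>R f" by simp
    then have "pole g + (1 / s) *\<^sub>R y = f" using s by (simp only: scaleR_cancel_left) auto
    with t \<open>t = s\<close> sp show "s \<in> {0..1} \<and> pole g + (1 / s) *\<^sub>R y \<in> cube_section H" by simp
  next
    assume "s \<in> {0..1} \<and> pole g + (1 / s) *\<^sub>R y \<in> cube_section H"
    then have "0 \<le> s \<and> s \<le> 1 \<and> pole g + (1 / s) *\<^sub>R y \<in> face g \<and> s *\<^sub>R pole g + y = s *\<^sub>R (pole g + (1 / s) *\<^sub>R y)"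
      using sp split by simp
    then show "s *\<^sub>R pole g + y \<in> convex hull (insert 0 (face g))" unfolding cone by blast
  qed
qed

text \<open>The slice of the cone at height \<open>s\<close> is the face scaled by \<open>s\<close>, of area \<open>s ^ (k - 1)\<close> times that of the
face; integrating over \<open>s\<close> gives the factor \<open>1 / k\<close>, and \<open>1 / norm g\<close> is the height of the cone.\<close>

lemma cone_volume:
  assumes g: "parallel_class g \<noteq> {}"
  shows "vol k (convex hull ({0} \<union> face g)) = face_area g / (real k * norm g)"
proof -
  let ?K = "convex hull (insert 0 (face g))" and ?W = "slice_direction g"
  define E where "E = emeasure (subspace_lborel ?W) {y. pole g + y \<in> cube_section H}"
  have k: "k > 0" using dim_pos by simp
  have KH: "?K \<subseteq> H"
    using subspace_H
    by (intro hull_minimal[where S = convex]) (auto simp: face_def subspace_0 subspace_imp_convex)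
  have "0 \<notin> affine hull (face g)"
  proof
    assume "0 \<in> affine hull (face g)"
    then obtain y where "y \<in> ?W" "0 = pole g + y" unfolding affine_hull_face[OF g] by blast
    then show False using slice_point(2)[OF g, of y] by simp
  qed
  then have dimK: "aff_dim ?K = int k"
    using aff_dim_face[OF g] k by (simp add: aff_dim_convex_hull aff_dim_insert)
  have "affine hull ?K = affine hull H"
    using aff_dim_eq_full_gen[OF KH] dimK subspace_H dim_H by (simp add: aff_dim_subspace)
  then have hullK: "affine hull ?K = (+) 0 ` H"
    using subspace_imp_affine[OF subspace_H] by (simp add: affine_hull_eq[THEN iffD2] image_def)
  have "closed (face g)"
  proof -
    have "face g = cube_section H \<inter> {x. x \<bullet> g = 1}" by (auto simp: face_def cube_section_eq)
    moreover have "closed {x. x \<bullet> g = 1}" by (intro closed_Collect_eq continuous_intros)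
    ultimately show ?thesis by (simp add: closed_Int closed_cube_section[OF subspace_H])
  qed
  moreover have "bounded (face g)" by (rule bounded_subset[OF bounded_cube_section]) (auto simp: face_def)
  ultimately have "compact ?K"
    by (intro compact_convex_hull) (simp add: compact_eq_bounded_closed)
  then have K [measurable]: "?K \<in> sets borel" by (simp add: borel_compact)
  have Wc: "{x \<in> H. x \<bullet> pole g = 0} = ?W"
    using normal_nonzero[OF g] by (auto simp: slice_direction_def pole_def)
  have p0: "pole g \<noteq> 0" using pole_inner_self[OF g] by auto
  have dimW: "dim ?W = k - 1" using dim_slice_direction[OF g] by simp
  have "emeasure (subspace_lborel H) ?K = (\<integral>\<^sup>+x. indicator ?K x \<partial>subspace_lborel H)" by simp
  also have "\<dots> = ennreal (norm (pole g)) *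
      (\<integral>\<^sup>+s. \<integral>\<^sup>+y. indicator ?K (s *\<^sub>R pole g + y) \<partial>subspace_lborel ?W \<partial>lborel)"
    using nn_integral_subspace_slices[OF subspace_H pole_mem[OF g] p0, of "indicator ?K"]
    unfolding Wc by simp
  also have "(\<integral>\<^sup>+s. \<integral>\<^sup>+y. indicator ?K (s *\<^sub>R pole g + y) \<partial>subspace_lborel ?W \<partial>lborel)
      = (\<integral>\<^sup>+s. (ennreal (s ^ (k - 1)) * indicator {0..1} s) * E \<partial>lborel)"
  proof (rule nn_integral_cong_AE)
    show "AE s in lborel. (\<integral>\<^sup>+y. indicator ?K (s *\<^sub>R pole g + y) \<partial>subspace_lborel ?W)
        = (ennreal (s ^ (k - 1)) * indicator {0..1} s) * E"
      using AE_lborel_singleton[of "0::real"]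
    proof eventually_elim
      case (elim s)
      let ?S = "{y. pole g + (1 / s) *\<^sub>R y \<in> cube_section H}"
      have [measurable]: "?S \<in> sets borel" by measurable
      have "(\<integral>\<^sup>+y. indicator ?K (s *\<^sub>R pole g + y) \<partial>subspace_lborel ?W)
          = (\<integral>\<^sup>+y. indicator {0..1} s * indicator ?S y \<partial>subspace_lborel ?W)"
        using AE_subspace_lborel[OF subspace_slice_direction]
        by (intro nn_integral_cong_AE, eventually_elim)
           (simp add: cone_mem_iff[OF g _ elim] indicator_def del: atLeastAtMost_iff)
      also have "\<dots> = indicator {0..1} s * emeasure (subspace_lborel ?W) ?S"
        by (subst nn_integral_cmult) auto
      also have "emeasure (subspace_lborel ?W) ?S = ennreal (\<bar>s\<bar> ^ (k - 1)) * E"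
      proof -
        have "{x. s *\<^sub>R x + 0 \<in> ?S} = {y. pole g + y \<in> cube_section H}" using elim by simp
        with emeasure_subspace_homothety[OF subspace_slice_direction elim subspace_0[OF subspace_slice_direction], of ?S g]
        show ?thesis by (simp add: E_def dimW)
      qed
      finally show ?case by (auto simp: indicator_def)
    qed
  qed
  also have "\<dots> = (\<integral>\<^sup>+s. ennreal (s ^ (k - 1)) * indicator {0..1} s \<partial>lborel) * E"
    by (rule nn_integral_multc) measurable
  also have "(\<integral>\<^sup>+s. ennreal (s ^ (k - 1)) * indicator {0..1} s \<partial>lborel)
      = ennreal (1 ^ k / real k - 0 ^ k / real k)"
  proof (rule nn_integral_FTC_Icc[where F = "\<lambda>s. s ^ k / real k"])
    show "((\<lambda>s. s ^ k / real k) has_real_derivative s ^ (k - 1)) (at s)" for s :: real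
      using k by (auto intro!: derivative_eq_intros)
  qed auto
  finally have em: "emeasure (subspace_lborel H) ?K
      = ennreal (norm (pole g)) * (ennreal (1 ^ k / real k - 0 ^ k / real k) * E)" .
  have np: "norm (pole g) = 1 / norm g"
    using normal_nonzero[OF g] by (simp add: pole_def power2_norm_eq_inner[symmetric] power2_eq_square field_simps)
  have "vol k ?K = measure (subspace_lborel H) {y. 0 + y \<in> ?K}"
    by (rule vol_eq_subspace_measure[OF subspace_H hullK dimK K])
  also have "\<dots> = norm (pole g) * ((1 / real k) * enn2real E)"
    using k by (simp add: measure_def em enn2real_mult zero_power)
  also have "enn2real E = face_area g" by (simp add: E_def face_area_def measure_def)
  finally show ?thesis by (simp add: np mult.commute)
qed

lemma cone_proportion:
  assumes g: "parallel_class g \<noteq> {}"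
  shows "vol k (convex hull ({0} \<union> face g)) / vol k (cube_section H)
    = 1 / 2 * ((\<Sum>i | span {v i} \<inter> face g = {centroid (k - 1) (face g)}. (norm (v i))\<^sup>2) / real k)"
proof -
  let ?V = "measure (subspace_lborel H) (cube_section H)"
  have V: "vol k (cube_section H) = ?V"
    using vol_cube_section[of H k] subspace_H dim_H by (simp add: grassmannian_def)
  have Vpos: "?V > 0" by (rule cube_section_measure_pos[OF subspace_H])
  have ng: "norm g > 0" using normal_nonzero[OF g] by simp
  have k: "real k > 0" using dim_pos by simp
  have "(\<Sum>i | span {v i} \<inter> face g = {centroid (k - 1) (face g)}. (norm (v i))\<^sup>2)
      = (\<Sum>i\<in>parallel_class g. g \<bullet> g)"
    unfolding pole_on_line_iff[OF g] Collect_mem_eq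
    by (rule sum.cong) (auto simp: parallel_class_def power2_norm_eq_inner)
  also have "\<dots> = real (card (parallel_class g)) * (g \<bullet> g)" by simp
  also have "\<dots> = 2 * face_area g / (norm g * ?V)"
    using area_balance[OF g] Vpos ng by (simp add: field_simps)
  finally show ?thesis
    unfolding V cone_volume[OF g] using Vpos ng k by (simp add: field_simps)
qed

end

theorem theorem1p1:
  fixes k :: nat and H :: "(real ^ 'n) set" and v :: "'n \<Rightarrow> real ^ 'n" and P :: "(real ^ 'n) set"
  assumes "2 \<le> k" and "k \<le> CARD('n)"
    and "H \<in> grassmannian k"
    and "local_maximizer (grassmannian_topology k) (\<lambda>H'. vol k (cube_section H')) H"
    and "\<And>i. v i = orth_proj H (axis i 1)"
    and "P = cube_section H"
  shows "P = (\<Inter>i. {x \<in> H. \<bar>x \<bullet> v i\<bar> \<le> 1})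
    \<and> (\<forall>i. v i \<noteq> 0 \<and> (P \<inter> {x \<in> H. x \<bullet> v i = 1}) facet_of P)
    \<and> (\<forall>i. span {v i} \<inter> (top_of_set H frontier_of P) \<noteq> {}
          \<and> (\<forall>x \<in> span {v i} \<inter> (top_of_set H frontier_of P).
                \<exists>F. F facet_of P \<and> x = centroid (k - 1) F))
    \<and> (\<forall>F. F facet_of P \<longrightarrow>
          vol k (convex hull ({0} \<union> F)) / vol k P =
          1 / 2 * ((\<Sum>i | span {v i} \<inter> F = {centroid (k - 1) F}. (norm (v i))\<^sup>2) / real k))"
proof -
  interpret maximal_cube_section k H v
    using assms by unfold_locales (auto simp: grassmannian_def)
  show ?thesis
    unfolding \<open>P = cube_section H\<close>
  proof (intro conjI allI impI)
    show "cube_section H = (\<Inter>i. {x \<in> H. \<bar>x \<bullet> v i\<bar> \<le> 1})"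
      by (auto simp: section_eq)
    show "v i \<noteq> 0" for i by (rule v_nonzero)
    show "(cube_section H \<inter> {x \<in> H. x \<bullet> v i = 1}) facet_of cube_section H" for i
      using face_facet[OF normal_v(1)] by (simp add: face_def)
    show "span {v i} \<inter> (top_of_set H frontier_of cube_section H) \<noteq> {}" for i
      by (simp add: line_meets_frontier)
    show "\<forall>x \<in> span {v i} \<inter> (top_of_set H frontier_of cube_section H).
        \<exists>F. F facet_of cube_section H \<and> x = centroid (k - 1) F" for i
      unfolding line_meets_frontier
      using face_facet[OF normal_v(1)] face_facet[OF normal_v(2)]
        centroid_face[OF normal_v(1), symmetric] centroid_face[OF normal_v(2), symmetric] by blast
    show "vol k (convex hull ({0} \<union> F)) / vol k (cube_section H) =
        1 / 2 * ((\<Sum>i | span {v i} \<inter> F = {centroid (k - 1) F}. (norm (v i))\<^sup>2) / real k)"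
      if F: "F facet_of cube_section H" for F
    proof -
      obtain g where "parallel_class g \<noteq> {}" "F = face g" using facet_eq_face[OF F] .
      then show ?thesis using cone_proportion by simp
    qed
  qed
qed

end
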